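(* Let $G$ be a graph with canonical decomposition $G=(G_k,A_k,B_k) \circ \dots \circ (G_1,A_1,B_1) \circ G_0$. Then $G$ is $\{2K_2,C_4,\text{chair}\}$-free if and only if $G_0$ is split or isomorphic to $C_5$, and each split indecomposable (canonical) component of $G$ having more than one vertex is a top-expanded spider.
   Context: All graphs are finite, with no loops or multiple edges. A graph is $\mathcal{F}$-free if it has no induced subgraph isomorphic to an element of $\mathcal{F}$. $2K_2$ is the disjoint union of two edges and $C_n$ the cycle on $n$ vertices. The chair is the tree with degree sequence $(3,2,1,1,1)$, i.e. vertices $a,b,c,d,e$ and edges $ae,ed,db,dc$. Canonical decomposition: A graph is split if its vertex set can be partitioned into an independent set and a clique (either may be empty). A splitted graph is a triple $(G,A,B)$ where $G$ is a split graph and $A,B$ is a partition of $V(G)$ into an independent set $A$ and a clique $B$. Isomorphism of splitted graphs $(G,A,B)\cong(G',A',B')$ means a graph isomorphism $V(G)\to V(G')$ carrying $A$ to $A'$. For a splitted graph $(G,A,B)$ and a graph $H$ on disjoint vertex sets, the composition $(G,A,B)\circ H$ is the graph formed by adding to the disjoint union $G+H$ all edges $uv$ with $u\in B$ and $v\in V(H)$. The composition of two splitted graphs is a splitted graph (take unions of the independent sets and of the cliques), and $\circ$ is associative. A graph is decomposable if it can be written as $(G,A,B)\circ H$ with $G$ and $H$ both having at least one vertex; otherwise it is indecomposable. By a theorem of Tyshkevich every graph $G$ has an expression $G=(G_k,A_k,B_k)\circ\dots\circ(G_1,A_1,B_1)\circ G_0$ with all $G_i$ indecomposable (and $k=0$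 if $G$ is indecomposable), unique up to isomorphism of the splitted graphs $(G_i,A_i,B_i)$, $i\ge1$, and of $G_0$; this is the canonical decomposition, and $G_0,\dots,G_k$ are the canonical (indecomposable) components of $G$. Spiders: A headless (prime) spider is a graph whose vertex set admits a partition into an independent set $A$ (the feet) and a clique $B$ (the body vertices) with $|A|=|B|\ge 2$, such that there is a bijection $f:A\to B$ for which either (a) each $v\in A$ is adjacent only to $f(v)$, or (b) each $v\in A$ is adjacent to all vertices of $B$ except $f(v)$. To substitute a (nonempty) graph $H$ for a vertex $v$ of $J$ is to take the disjoint union of $H$ and $J-v$ and add all edges $uw$ with $u\in V(H)$ and $w\in N_J(v)$. A top-expanded spider is a graph obtained by substituting complete graphs (possibly single vertices) for body vertices in a headless spider. *)

theory Defs
  imports "Graph_Theory.Graph_Theory"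
begin

text \<open>
  A finite graph without loops or multiple edges is a \<open>pair_graph\<close>: an edge \<open>uv\<close> is
  represented by the two arcs \<open>(u, v)\<close> and \<open>(v, u)\<close>. The graph without vertices is allowed.
\<close>

definition graph_of_edges :: "'a set \<Rightarrow> ('a \<times> 'a) set \<Rightarrow> 'a pair_pre_digraph" where
  "graph_of_edges V E = mk_symmetric (with_proj \<lparr>pverts = V, parcs = E\<rparr>)"

definition two_K2 :: "nat pair_pre_digraph" where
  "two_K2 = graph_of_edges {0, 1, 2, 3} {(0, 1), (2, 3)}"

text \<open>The cycle on \<open>n\<close> vertices; only meaningful for \<open>n \<ge> 3\<close>.\<close>

definition cycle_graph :: "nat \<Rightarrow> nat pair_pre_digraph" where
  "cycle_graph n = graph_of_edges {..<n} {(i, Suc i mod n) | i. i < n}"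

text \<open>Vertices \<open>a, b, c, d, e\<close> are \<open>0, 1, 2, 3, 4\<close>; the edges are \<open>ae, ed, db, dc\<close>.\<close>

definition chair :: "nat pair_pre_digraph" where
  "chair = graph_of_edges {0, 1, 2, 3, 4} {(0, 4), (4, 3), (3, 1), (3, 2)}"

definition free_of :: "'b pair_pre_digraph set \<Rightarrow> 'a pair_pre_digraph \<Rightarrow> bool" where
  "free_of F G \<longleftrightarrow>
     \<not> (\<exists>H\<in>F. \<exists>S. induced_subgraph S (with_proj G) \<and> digraph_iso S (with_proj H))"


definition independent_set :: "'a pair_pre_digraph \<Rightarrow> 'a set \<Rightarrow> bool" where
  "independent_set G A \<longleftrightarrow> A \<subseteq> pverts G \<and> (\<forall>u\<in>A. \<forall>v\<in>A. (u, v) \<notin> parcs G)"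

definition clique :: "'a pair_pre_digraph \<Rightarrow> 'a set \<Rightarrow> bool" where
  "clique G B \<longleftrightarrow> B \<subseteq> pverts G \<and> (\<forall>u\<in>B. \<forall>v\<in>B. u \<noteq> v \<longrightarrow> (u, v) \<in> parcs G)"

text \<open>The parts may be empty.\<close>

definition split_partition :: "'a pair_pre_digraph \<Rightarrow> 'a set \<Rightarrow> 'a set \<Rightarrow> bool" where
  "split_partition G A B \<longleftrightarrow>
     A \<union> B = pverts G \<and> A \<inter> B = {} \<and> independent_set G A \<and> clique G B"

definition split_graph :: "'a pair_pre_digraph \<Rightarrow> bool" where
  "split_graph G \<longleftrightarrow> pair_graph G \<and> (\<exists>A B. split_partition G A B)"

type_synonym 'a splitted = "'a pair_pre_digraph \<times> 'a set \<times> 'a set"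

fun splitted_graph :: "'a splitted \<Rightarrow> bool" where
  "splitted_graph (G, A, B) \<longleftrightarrow> pair_graph G \<and> split_partition G A B"

text \<open>
  The composition \<open>(G, A, B) \<circ> H\<close>. It is meant for \<open>G\<close> and \<open>H\<close> on disjoint vertex sets;
  this is required separately wherever it is used.
\<close>

fun compose :: "'a splitted \<Rightarrow> 'a pair_pre_digraph \<Rightarrow> 'a pair_pre_digraph" where
  "compose (G, A, B) H =
     \<lparr>pverts = pverts G \<union> pverts H,
      parcs = parcs G \<union> parcs H \<union> B \<times> pverts H \<union> pverts H \<times> B\<rparr>"

definition decomposable :: "'a pair_pre_digraph \<Rightarrow> bool" where
  "decomposable G \<longleftrightarrow>
     (\<exists>S A B H. splitted_graph (S, A, B) \<and> pair_graph H \<and> pverts S \<inter> pverts H = {} \<and>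
        pverts S \<noteq> {} \<and> pverts H \<noteq> {} \<and> G = compose (S, A, B) H)"

definition indecomposable :: "'a pair_pre_digraph \<Rightarrow> bool" where
  "indecomposable G \<longleftrightarrow> \<not> decomposable G"

text \<open>
  For \<open>Xs = [(G\<^sub>k, A\<^sub>k, B\<^sub>k), \<dots>, (G\<^sub>1, A\<^sub>1, B\<^sub>1)]\<close>, the components are
  \<open>[G\<^sub>k, \<dots>, G\<^sub>1, G\<^sub>0]\<close>.
\<close>

definition components :: "'a splitted list \<Rightarrow> 'a pair_pre_digraph \<Rightarrow> 'a pair_pre_digraph list" where
  "components Xs G0 = map fst Xs @ [G0]"

text \<open>
  As \<open>\<circ>\<close> is associative, the iterated composition may be bracketed to the right. For \<open>k \<ge> 1\<close>
  the components are required to be nonempty: otherwise empty components could be inserted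
  freely and the decomposition would not be unique. For \<open>k = 0\<close> the graph \<open>G\<^sub>0 = G\<close> may be
  empty, so that the empty graph has a decomposition too.
\<close>

definition canonical_decomposition ::
    "'a pair_pre_digraph \<Rightarrow> 'a splitted list \<Rightarrow> 'a pair_pre_digraph \<Rightarrow> bool" where
  "canonical_decomposition G Xs G0 \<longleftrightarrow>
     (\<forall>X\<in>set Xs. splitted_graph X) \<and> pair_graph G0 \<and>
     (\<forall>C\<in>set (components Xs G0). indecomposable C) \<and>
     (Xs \<noteq> [] \<longrightarrow> (\<forall>C\<in>set (components Xs G0). pverts C \<noteq> {})) \<and>
     sorted_wrt (\<lambda>C D. pverts C \<inter> pverts D = {}) (components Xs G0) \<and>
     G = foldr compose Xs G0"


definition neighbours :: "'a pair_pre_digraph \<Rightarrow> 'a \<Rightarrow> 'a set" where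
  "neighbours G v = {w. (v, w) \<in> parcs G}"

text \<open>\<open>J\<close> is a headless spider with set of feet \<open>A\<close> and set of body vertices \<open>B\<close>.\<close>

definition headless_spider :: "'a pair_pre_digraph \<Rightarrow> 'a set \<Rightarrow> 'a set \<Rightarrow> bool" where
  "headless_spider J A B \<longleftrightarrow>
     pair_graph J \<and> split_partition J A B \<and> card A = card B \<and> card A \<ge> 2 \<and>
     (\<exists>f. bij_betw f A B \<and>
        ((\<forall>v\<in>A. neighbours J v = {f v}) \<or> (\<forall>v\<in>A. neighbours J v = B - {f v})))"

text \<open>
  Substituting \<open>H\<close> for the vertex \<open>v\<close> of \<open>J\<close>; meant for \<open>H\<close> disjoint from \<open>J - v\<close>.
\<close>

definition substitute :: "'a pair_pre_digraph \<Rightarrow> 'a \<Rightarrow> 'a pair_pre_digraph \<Rightarrow> 'a pair_pre_digraph" where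
  "substitute J v H =
     \<lparr>pverts = (pverts J - {v}) \<union> pverts H,
      parcs = {(x, y) \<in> parcs J. x \<noteq> v \<and> y \<noteq> v} \<union> parcs H \<union>
              pverts H \<times> neighbours J v \<union> neighbours J v \<times> pverts H\<rparr>"

text \<open>
  \<open>expanded_spider G B\<close>: \<open>G\<close> arises from a headless spider by substituting nonempty complete
  graphs for some of its body vertices, and \<open>B\<close> is the set of those body vertices for which
  nothing has been substituted yet.
\<close>

inductive expanded_spider :: "'a pair_pre_digraph \<Rightarrow> 'a set \<Rightarrow> bool" where
  spider: "headless_spider J A B \<Longrightarrow> expanded_spider J B"
| expand: "expanded_spider G B \<Longrightarrow> v \<in> B \<Longrightarrow>
    complete_digraph n (with_proj K) \<Longrightarrow> n \<ge> 1 \<Longrightarrow> pverts K \<inter> (pverts G - {v}) = {} \<Longrightarrow>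
    expanded_spider (substitute G v K) (B - {v})"

definition top_expanded_spider :: "'a pair_pre_digraph \<Rightarrow> bool" where
  "top_expanded_spider G \<longleftrightarrow> (\<exists>B. expanded_spider G B)"

end

theory Submission
  imports Defs
begin

text \<open>
  In a composition, every alternating 4-cycle (edges \<open>ab\<close>, \<open>cd\<close>, non-edges \<open>bc\<close>, \<open>da\<close>) lies
  inside one of the two factors. The alternating 4-cycles of each forbidden graph cover it and are
  linked by common vertices, so a graph is free of them iff all its canonical components are. It
  remains to treat indecomposable graphs.

  A non-split \<open>{2K\<^sub>2, C\<^sub>4}\<close>-free graph contains an induced \<open>C\<^sub>5\<close>. Every other vertex is adjacent
  to all or to none of its vertices, the former form a clique and the latter an independent set, so
  an indecomposable such graph is \<open>C\<^sub>5\<close>.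

  In a split graph with independent set \<open>A\<close> and clique \<open>B\<close>, chair-freeness says that incomparable
  neighbourhoods \<open>N(x) \<inter> A\<close>, \<open>N(y) \<inter> A\<close> of \<open>x, y \<in> B\<close> differ by the exchange of one vertex. If these
  neighbourhoods had different sizes, the larger ones would contain the smaller ones and the graph
  would be decomposable. Hence any two are equal or differ by an exchange; as indecomposability also
  excludes isolated and dominating vertices in \<open>A\<close>, they are all the singletons or all the
  complements of singletons in \<open>A\<close>.
\<close>

section \<open>Induced copies of the three forbidden graphs\<close>

lemma pair_wf_digraphD:
  assumes "pair_wf_digraph G" "(u, v) \<in> parcs G"
  shows "u \<in> pverts G" "v \<in> pverts G"
  using assms pair_wf_digraph.wellformed' by metis+

lemma pair_graphD:
  assumes "pair_graph G"
  shows "finite (pverts G)"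
    and "(u, v) \<in> parcs G \<Longrightarrow> u \<in> pverts G"
    and "(u, v) \<in> parcs G \<Longrightarrow> v \<in> pverts G"
    and "(u, v) \<in> parcs G \<Longrightarrow> (v, u) \<in> parcs G"
    and "(u, u) \<notin> parcs G"
proof -
  interpret pair_graph G by fact
  show "finite (pverts G)" by (rule pair_finite_verts)
  show "(u, v) \<in> parcs G \<Longrightarrow> u \<in> pverts G" by (rule in_arcsD1)
  show "(u, v) \<in> parcs G \<Longrightarrow> v \<in> pverts G" by (rule in_arcsD2)
  show "(u, v) \<in> parcs G \<Longrightarrow> (v, u) \<in> parcs G" by (rule arcs_symmetric)
  show "(u, u) \<notin> parcs G" using no_loops' by blast
qed

lemma pair_graph_imp_pair_wf_digraph: "pair_graph G \<Longrightarrow> pair_wf_digraph G"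
  by (auto simp: pair_wf_digraph_def dest: pair_graphD)

lemma pair_graphI:
  assumes "finite (pverts G)" "parcs G \<subseteq> pverts G \<times> pverts G" "sym (parcs G)"
    and "\<And>u. (u, u) \<notin> parcs G"
  shows "pair_graph G"
proof -
  have "finite (parcs G)"
    using assms(1,2) finite_subset by blast
  then show ?thesis
    using assms by unfold_locales (auto simp: symmetric_def)
qed

text \<open>An embedding of \<open>F\<close> as an induced subgraph, expressed by a vertex map
  alone. It replaces the pair of a subgraph and a digraph isomorphism in
  \<open>free_of\<close>.\<close>

definition induced_copy :: "'b pair_pre_digraph \<Rightarrow> 'a pair_pre_digraph \<Rightarrow> ('b \<Rightarrow> 'a) \<Rightarrow> bool" where
  "induced_copy F G h \<longleftrightarrow> inj_on h (pverts F) \<and> h ` pverts F \<subseteq> pverts G \<and>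
     (\<forall>i\<in>pverts F. \<forall>j\<in>pverts F. (h i, h j) \<in> parcs G \<longleftrightarrow> (i, j) \<in> parcs F)"

text \<open>Under \<open>with_proj\<close> an arc is the pair of its ends, so the arc part of an
  isomorphism is determined by its vertex part. The map \<open>h\<close> is the inverse of that
  vertex part.\<close>

lemma digraph_iso_with_proj_iff:
  assumes G: "pair_wf_digraph G" and F: "pair_wf_digraph F"
  shows "digraph_iso (with_proj G) (with_proj F) \<longleftrightarrow>
    (\<exists>h. induced_copy F G h \<and> h ` pverts F = pverts G)"
proof
  assume "digraph_iso (with_proj G) (with_proj F)"
  then obtain f where f: "pre_digraph.digraph_isomorphism (with_proj G) f"
    and F_eq: "with_proj F = app_iso f (with_proj G)"
    by (auto simp: digraph_iso_def)
  let ?k = "iso_verts f"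
  have verts: "pverts F = ?k ` pverts G" and arcs: "parcs F = iso_arcs f ` parcs G"
    and tl: "iso_tail f = fst" and hd: "iso_head f = snd"
    using F_eq by (auto simp: with_proj_def app_iso_def)
  have inj: "inj_on ?k (pverts G)"
    and ends: "\<And>a. a \<in> parcs G \<Longrightarrow> ?k (fst a) = fst (iso_arcs f a) \<and> ?k (snd a) = snd (iso_arcs f a)"
    using f by (auto simp: pre_digraph.digraph_isomorphism_def tl hd)
  have "iso_arcs f (u, v) = (?k u, ?k v)" if "(u, v) \<in> parcs G" for u v
    using ends[OF that] by (simp add: prod_eq_iff)
  then have arcs': "parcs F = (\<lambda>(u, v). (?k u, ?k v)) ` parcs G"
    unfolding arcs by (intro image_cong) auto
  have adj: "(?k u, ?k v) \<in> parcs F \<longleftrightarrow> (u, v) \<in> parcs G"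
    if "u \<in> pverts G" "v \<in> pverts G" for u v
  proof
    assume "(?k u, ?k v) \<in> parcs F"
    then obtain a b where ab: "(a, b) \<in> parcs G" "?k u = ?k a" "?k v = ?k b"
      unfolding arcs' by auto
    then have "u = a" "v = b"
      using that inj pair_wf_digraphD[OF G ab(1)] by (auto simp: inj_on_eq_iff)
    then show "(u, v) \<in> parcs G" using ab(1) by simp
  qed (force simp: arcs')
  let ?h = "the_inv_into (pverts G) ?k"
  have "induced_copy F G ?h \<and> ?h ` pverts F = pverts G"
    unfolding induced_copy_def verts using inj adj
    by (auto simp: the_inv_into_f_f inj_on_the_inv_into image_image)
  then show "\<exists>h. induced_copy F G h \<and> h ` pverts F = pverts G" by blast
next
  assume "\<exists>h. induced_copy F G h \<and> h ` pverts F = pverts G"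
  then obtain h where inj: "inj_on h (pverts F)" and im: "h ` pverts F = pverts G"
    and adj: "\<And>i j. i \<in> pverts F \<Longrightarrow> j \<in> pverts F \<Longrightarrow> (h i, h j) \<in> parcs G \<longleftrightarrow> (i, j) \<in> parcs F"
    by (auto simp: induced_copy_def)
  define f where "f = \<lparr>iso_verts = h, iso_arcs = map_prod h h, iso_head = snd, iso_tail = fst\<rparr>"
  have arcs: "parcs G = map_prod h h ` parcs F"
  proof (intro equalityI subrelI)
    fix u v assume uv: "(u, v) \<in> parcs G"
    then obtain i j where "i \<in> pverts F" "j \<in> pverts F" "u = h i" "v = h j"
      using pair_wf_digraphD[OF G uv] im by blast
    then show "(u, v) \<in> map_prod h h ` parcs F"
      using adj uv by (metis map_prod_imageI)
  next
    fix u v assume "(u, v) \<in> map_prod h h ` parcs F"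
    then show "(u, v) \<in> parcs G"
      using adj pair_wf_digraphD[OF F] by auto
  qed
  have "inj_on (map_prod h h) (pverts F \<times> pverts F)"
    using inj by (rule map_prod_inj_on[OF _ inj])
  then have "inj_on (map_prod h h) (parcs F)"
    by (rule inj_on_subset) (auto dest: pair_wf_digraphD[OF F])
  then have "pre_digraph.digraph_isomorphism (with_proj F) f"
    using inj F by (auto simp: pre_digraph.digraph_isomorphism_def f_def wf_digraph_wp_iff)
  moreover have "with_proj G = app_iso f (with_proj F)"
    using im arcs by (auto simp: with_proj_def app_iso_def f_def)
  ultimately have "digraph_iso (with_proj F) (with_proj G)"
    by (auto simp: digraph_iso_def)
  then show "digraph_iso (with_proj G) (with_proj F)"
    by (rule digraph_iso_swap[rotated]) (simp add: wf_digraph_wp_iff F)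
qed

text \<open>Compatibility forces the tail and head maps of \<open>S\<close> to be the projections,
  so an induced subgraph is determined by its vertex set.\<close>

lemma induced_subgraph_with_proj_iff:
  assumes "pair_wf_digraph G"
  shows "induced_subgraph S (with_proj G) \<longleftrightarrow>
    (\<exists>W\<subseteq>pverts G. S = with_proj \<lparr>pverts = W, parcs = parcs G \<inter> W \<times> W\<rparr>)"
proof
  assume "induced_subgraph S (with_proj G)"
  then show "\<exists>W\<subseteq>pverts G. S = with_proj \<lparr>pverts = W, parcs = parcs G \<inter> W \<times> W\<rparr>"
    by (intro exI[of _ "verts S"])
       (auto simp: induced_subgraph_def subgraph_def compatible_def with_proj_def
         intro!: pre_digraph.equality)
next
  assume "\<exists>W\<subseteq>pverts G. S = with_proj \<lparr>pverts = W, parcs = parcs G \<inter> W \<times> W\<rparr>"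
  then show "induced_subgraph S (with_proj G)"
    using assms
    by (auto simp: induced_subgraph_def subgraph_def compatible_def wf_digraph_wp_iff)
       (auto simp: pair_wf_digraph_def)
qed

text \<open>An isomorphism from the subgraph induced on \<open>W\<close> corresponds to an embedding
  with image \<open>W\<close>; conversely the image of any embedding serves as
  \<open>W\<close>.\<close>

lemma free_of_iff_no_induced_copy:
  assumes G: "pair_wf_digraph G" and Fs: "\<And>F. F \<in> Fs \<Longrightarrow> pair_wf_digraph F"
  shows "free_of Fs G \<longleftrightarrow> (\<forall>F\<in>Fs. \<nexists>h. induced_copy F G h)"
proof -
  have "(\<exists>S. induced_subgraph S (with_proj G) \<and> digraph_iso S (with_proj F)) \<longleftrightarrow>
      (\<exists>h. induced_copy F G h)" if "F \<in> Fs" for F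
  proof -
    let ?ind = "\<lambda>W. \<lparr>pverts = W, parcs = parcs G \<inter> W \<times> W\<rparr>"
    have "(\<exists>S. induced_subgraph S (with_proj G) \<and> digraph_iso S (with_proj F)) \<longleftrightarrow>
        (\<exists>W\<subseteq>pverts G. digraph_iso (with_proj (?ind W)) (with_proj F))"
      by (auto simp: induced_subgraph_with_proj_iff[OF G])
    also have "\<dots> \<longleftrightarrow> (\<exists>W\<subseteq>pverts G. \<exists>h. induced_copy F (?ind W) h \<and> h ` pverts F = W)"
    proof -
      have "pair_wf_digraph (?ind W)" for W by unfold_locales auto
      then show ?thesis by (simp add: digraph_iso_with_proj_iff Fs that)
    qed
    also have "\<dots> \<longleftrightarrow> (\<exists>h. induced_copy F G h)"
    proof
      assume "\<exists>h. induced_copy F G h"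
      then obtain h where "induced_copy F G h" ..
      then have "h ` pverts F \<subseteq> pverts G" "induced_copy F (?ind (h ` pverts F)) h"
        by (auto simp: induced_copy_def)
      then show "\<exists>W\<subseteq>pverts G. \<exists>h. induced_copy F (?ind W) h \<and> h ` pverts F = W"
        by blast
    qed (auto simp: induced_copy_def)
    finally show ?thesis .
  qed
  then show ?thesis by (auto simp: free_of_def)
qed

text \<open>In this pattern and the next two, the listed edges and non-edges force most vertices to
  be distinct in a symmetric loopless graph. Opposite corners of the 4-cycle and the leaves
  \<open>b\<close>, \<open>c\<close> of the chair have the same adjacencies to the other vertices,
  so these pairs get explicit inequalities.\<close>

definition has_two_K2 :: "'a pair_pre_digraph \<Rightarrow> bool" where
  "has_two_K2 G \<longleftrightarrow> (\<exists>a b c d. (a, b) \<in> parcs G \<and> (c, d) \<in> parcs G \<and>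
     (a, c) \<notin> parcs G \<and> (a, d) \<notin> parcs G \<and> (b, c) \<notin> parcs G \<and> (b, d) \<notin> parcs G)"

definition has_C4 :: "'a pair_pre_digraph \<Rightarrow> bool" where
  "has_C4 G \<longleftrightarrow> (\<exists>a b c d. a \<noteq> c \<and> b \<noteq> d \<and>
     (a, b) \<in> parcs G \<and> (b, c) \<in> parcs G \<and> (c, d) \<in> parcs G \<and> (d, a) \<in> parcs G \<and>
     (a, c) \<notin> parcs G \<and> (b, d) \<notin> parcs G)"

definition has_chair :: "'a pair_pre_digraph \<Rightarrow> bool" where
  "has_chair G \<longleftrightarrow> (\<exists>a b c d e. b \<noteq> c \<and>
     (a, e) \<in> parcs G \<and> (e, d) \<in> parcs G \<and> (d, b) \<in> parcs G \<and> (d, c) \<in> parcs G \<and>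
     (a, b) \<notin> parcs G \<and> (a, c) \<notin> parcs G \<and> (a, d) \<notin> parcs G \<and>
     (b, c) \<notin> parcs G \<and> (b, e) \<notin> parcs G \<and> (c, e) \<notin> parcs G)"

lemma has_two_K2I:
  assumes "(a, b) \<in> parcs G" "(c, d) \<in> parcs G"
    "(a, c) \<notin> parcs G" "(a, d) \<notin> parcs G" "(b, c) \<notin> parcs G" "(b, d) \<notin> parcs G"
  shows "has_two_K2 G"
  using assms unfolding has_two_K2_def by blast

lemma has_C4I:
  assumes "a \<noteq> c" "b \<noteq> d"
    "(a, b) \<in> parcs G" "(b, c) \<in> parcs G" "(c, d) \<in> parcs G" "(d, a) \<in> parcs G"
    "(a, c) \<notin> parcs G" "(b, d) \<notin> parcs G"
  shows "has_C4 G"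
  using assms unfolding has_C4_def by blast

lemma has_chairI:
  assumes "b \<noteq> c"
    "(a, e) \<in> parcs G" "(e, d) \<in> parcs G" "(d, b) \<in> parcs G" "(d, c) \<in> parcs G"
    "(a, b) \<notin> parcs G" "(a, c) \<notin> parcs G" "(a, d) \<notin> parcs G"
    "(b, c) \<notin> parcs G" "(b, e) \<notin> parcs G" "(c, e) \<notin> parcs G"
  shows "has_chair G"
  using assms unfolding has_chair_def by blast

definition obstruction_free :: "'a pair_pre_digraph \<Rightarrow> bool" where
  "obstruction_free G \<longleftrightarrow> \<not> has_two_K2 G \<and> \<not> has_C4 G \<and> \<not> has_chair G"

section \<open>The forbidden graphs written out and matched with their edge patterns\<close>

lemma graph_of_edges_sel [simp]:
  "pverts (graph_of_edges V E) = V"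
  "parcs (graph_of_edges V E) = E \<union> E\<inverse>"
  by (auto simp: graph_of_edges_def parcs_mk_symmetric)

lemma cycle_graph_sel:
  "pverts (cycle_graph 4) = {0, 1, 2, 3}"
  "parcs (cycle_graph 4) = {(0, 1), (1, 2), (2, 3), (3, 0)} \<union> {(0, 1), (1, 2), (2, 3), (3, 0)}\<inverse>"
  "pverts (cycle_graph 5) = {0, 1, 2, 3, 4}"
  "parcs (cycle_graph 5) =
     {(0, 1), (1, 2), (2, 3), (3, 4), (4, 0)} \<union> {(0, 1), (1, 2), (2, 3), (3, 4), (4, 0)}\<inverse>"
proof -
  have 4: "{..<4} = {0, 1, 2, 3 :: nat}" and 5: "{..<5} = {0, 1, 2, 3, 4 :: nat}" by auto
  have "{(i, Suc i mod 4) | i. i < 4} = (\<lambda>i. (i, Suc i mod 4)) ` {..<4}"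
    "{(i, Suc i mod 5) | i. i < 5} = (\<lambda>i. (i, Suc i mod 5)) ` {..<5}" by auto
  then have *: "{(i, Suc i mod 4) | i. i < 4} = {(0, 1), (1, 2), (2, 3), (3, 0)}"
    "{(i, Suc i mod 5) | i. i < 5} = {(0, 1), (1, 2), (2, 3), (3, 4), (4, 0)}"
    unfolding 4 5 by (simp_all del: One_nat_def add: One_nat_def[symmetric])
  show
    "pverts (cycle_graph 4) = {0, 1, 2, 3}"
    "parcs (cycle_graph 4) = {(0, 1), (1, 2), (2, 3), (3, 0)} \<union> {(0, 1), (1, 2), (2, 3), (3, 0)}\<inverse>"
    "pverts (cycle_graph 5) = {0, 1, 2, 3, 4}"
    "parcs (cycle_graph 5) =
       {(0, 1), (1, 2), (2, 3), (3, 4), (4, 0)} \<union> {(0, 1), (1, 2), (2, 3), (3, 4), (4, 0)}\<inverse>"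
    unfolding cycle_graph_def graph_of_edges_sel 4 5 * by (rule refl)+
qed

lemma induced_copy_two_K2_iff:
  assumes "pair_graph G"
  shows "(\<exists>h. induced_copy two_K2 G h) \<longleftrightarrow> has_two_K2 G"
proof
  assume "\<exists>h. induced_copy two_K2 G h"
  then obtain h where h: "induced_copy two_K2 G h" ..
  have iff: "(h i, h j) \<in> parcs G \<longleftrightarrow> (i, j) \<in> parcs two_K2"
    if "i \<in> pverts two_K2" "j \<in> pverts two_K2" for i j
    using that h by (auto simp: induced_copy_def)
  show "has_two_K2 G"
    by (intro has_two_K2I[of "h 0" "h 1" _ "h 2" "h 3"]) (simp_all add: iff two_K2_def)
next
  assume "has_two_K2 G"
  then obtain a b c d where *: "(a, b) \<in> parcs G" "(c, d) \<in> parcs G"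
     "(a, c) \<notin> parcs G" "(a, d) \<notin> parcs G" "(b, c) \<notin> parcs G" "(b, d) \<notin> parcs G"
    unfolding has_two_K2_def by blast
  note G = pair_graphD[OF assms]
  have sym: "(b, a) \<in> parcs G" "(d, c) \<in> parcs G"
    "(c, a) \<notin> parcs G" "(d, a) \<notin> parcs G" "(c, b) \<notin> parcs G" "(d, b) \<notin> parcs G"
    using * G(4) by blast+
  have ne: "a \<noteq> b" "a \<noteq> c" "a \<noteq> d" "b \<noteq> c" "b \<noteq> d" "c \<noteq> d" using * G by blast+
  \<comment> \<open>Indexing into the list serves as the vertex map on
    \<open>{0, 1, 2, 3}\<close>.\<close>
  have "induced_copy two_K2 G ((!) [a, b, c, d])"
    unfolding induced_copy_def two_K2_def using * sym ne G(2,3)[OF *(1)] G(2,3)[OF *(2)]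
    by (auto simp: G(5))
  then show "\<exists>h. induced_copy two_K2 G h" by blast
qed

lemma induced_copy_C4_iff:
  assumes "pair_graph G"
  shows "(\<exists>h. induced_copy (cycle_graph 4) G h) \<longleftrightarrow> has_C4 G"
proof
  assume "\<exists>h. induced_copy (cycle_graph 4) G h"
  then obtain h where h: "induced_copy (cycle_graph 4) G h" ..
  then have "h 0 \<noteq> h 2" "h 1 \<noteq> h 3"
    by (auto simp: induced_copy_def cycle_graph_sel inj_on_eq_iff)
  have iff: "(h i, h j) \<in> parcs G \<longleftrightarrow> (i, j) \<in> parcs (cycle_graph 4)"
    if "i \<in> pverts (cycle_graph 4)" "j \<in> pverts (cycle_graph 4)" for i j
    using that h by (auto simp: induced_copy_def)
  from \<open>h 0 \<noteq> h 2\<close> \<open>h 1 \<noteq> h 3\<close> show "has_C4 G"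
    by (intro has_C4I[of "h 0" "h 2" "h 1" "h 3"]) (simp_all add: iff cycle_graph_sel)
next
  assume "has_C4 G"
  then obtain a b c d where *: "(a, b) \<in> parcs G" "(b, c) \<in> parcs G" "(c, d) \<in> parcs G"
     "(d, a) \<in> parcs G" "(a, c) \<notin> parcs G" "(b, d) \<notin> parcs G" and ne: "a \<noteq> c" "b \<noteq> d"
    unfolding has_C4_def by blast
  note G = pair_graphD[OF assms]
  have sym: "(b, a) \<in> parcs G" "(c, b) \<in> parcs G" "(d, c) \<in> parcs G" "(a, d) \<in> parcs G"
    "(c, a) \<notin> parcs G" "(d, b) \<notin> parcs G"
    using * G(4) by blast+
  have "a \<noteq> b" "a \<noteq> d" "b \<noteq> c" "c \<noteq> d" using * G by blast+
  then have "induced_copy (cycle_graph 4) G ((!) [a, b, c, d])"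
    unfolding induced_copy_def cycle_graph_sel using * sym ne G(2,3)[OF *(1)] G(2,3)[OF *(3)]
    by (auto simp: G(5))
  then show "\<exists>h. induced_copy (cycle_graph 4) G h" by blast
qed

lemma induced_copy_chair_iff:
  assumes "pair_graph G"
  shows "(\<exists>h. induced_copy chair G h) \<longleftrightarrow> has_chair G"
proof
  assume "\<exists>h. induced_copy chair G h"
  then obtain h where h: "induced_copy chair G h" ..
  then have "h 1 \<noteq> h 2"
    by (auto simp: induced_copy_def chair_def inj_on_eq_iff)
  have iff: "(h i, h j) \<in> parcs G \<longleftrightarrow> (i, j) \<in> parcs chair"
    if "i \<in> pverts chair" "j \<in> pverts chair" for i j
    using that h by (auto simp: induced_copy_def)
  from \<open>h 1 \<noteq> h 2\<close> show "has_chair G"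
    by (intro has_chairI[of "h 1" "h 2" "h 0" "h 4" _ "h 3"]) (simp_all add: iff chair_def)
next
  assume "has_chair G"
  then obtain a b c d e where *: "(a, e) \<in> parcs G" "(e, d) \<in> parcs G" "(d, b) \<in> parcs G"
     "(d, c) \<in> parcs G" "(a, b) \<notin> parcs G" "(a, c) \<notin> parcs G" "(a, d) \<notin> parcs G"
     "(b, c) \<notin> parcs G" "(b, e) \<notin> parcs G" "(c, e) \<notin> parcs G" and ne: "b \<noteq> c"
    unfolding has_chair_def by blast
  note G = pair_graphD[OF assms]
  have sym: "(e, a) \<in> parcs G" "(d, e) \<in> parcs G" "(b, d) \<in> parcs G" "(c, d) \<in> parcs G"
    "(b, a) \<notin> parcs G" "(c, a) \<notin> parcs G" "(d, a) \<notin> parcs G" "(c, b) \<notin> parcs G" "(e, b) \<notin> parcs G" "(e, c) \<notin> parcs G"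
    using * G(4) by blast+
  have "a \<noteq> b" "a \<noteq> c" "a \<noteq> d" "a \<noteq> e" "b \<noteq> d" "b \<noteq> e" "c \<noteq> d" "c \<noteq> e" "d \<noteq> e"
    using * G by blast+
  then have "induced_copy chair G ((!) [a, b, c, d, e])"
    unfolding induced_copy_def chair_def
    using * sym ne G(2,3)[OF *(1)] G(2,3)[OF *(3)] G(2,3)[OF *(4)]
    by (auto simp: G(5))
  then show "\<exists>h. induced_copy chair G h" by blast
qed

lemma free_of_iff_obstruction_free:
  assumes "pair_graph G"
  shows "free_of {two_K2, cycle_graph 4, chair} G \<longleftrightarrow> obstruction_free G"
proof -
  have "pair_wf_digraph F" if "F \<in> {two_K2, cycle_graph 4, chair}" for F
    using that
    by (auto simp: two_K2_def chair_def pair_wf_digraph_def cycle_graph_sel)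
  moreover have "pair_wf_digraph G"
    using assms by (rule pair_graph_imp_pair_wf_digraph)
  ultimately have "free_of {two_K2, cycle_graph 4, chair} G \<longleftrightarrow>
      (\<forall>F\<in>{two_K2, cycle_graph 4, chair}. \<nexists>h. induced_copy F G h)"
    by (intro free_of_iff_no_induced_copy) blast+
  then show ?thesis
    using induced_copy_two_K2_iff[OF assms] induced_copy_C4_iff[OF assms]
      induced_copy_chair_iff[OF assms]
    by (simp add: obstruction_free_def del: not_ex)
qed

section \<open>Composition\<close>

lemma pair_graph_compose:
  assumes "splitted_graph (S, A, B)" "pair_graph H" "pverts S \<inter> pverts H = {}"
  shows "pair_graph (compose (S, A, B) H)"
proof -
  have "pair_graph S" and B: "B \<subseteq> pverts S" using assms(1) by (auto simp: split_partition_def)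
  note S = pair_graphD[OF this(1)] and H = pair_graphD[OF assms(2)]
  show ?thesis
    using B assms(3)
    by (intro pair_graphI) (auto simp: sym_def S(1,5) H(1,5) intro: S(2-4) H(2-4))
qed

text \<open>A vertex of \<open>A\<close> has neighbours only in \<open>B\<close>, and a vertex of
  \<open>B\<close> has non-neighbours only in \<open>A\<close>. Hence a cycle alternating between
  edges and non-edges that meets \<open>A\<close> or \<open>B\<close> alternates between them and
  never reaches \<open>H\<close>. The pairs \<open>ac\<close> and \<open>bd\<close> are left free,
  so the lemma serves all three patterns.\<close>

lemma alternating_cycle_compose:
  fixes A B :: "'a set"
  assumes "splitted_graph (S, A, B)" "pair_graph H" "pverts S \<inter> pverts H = {}"
  defines "E \<equiv> parcs (compose (S, A, B) H)"
  assumes cyc: "(a, b) \<in> E" "(c, d) \<in> E" "(b, c) \<notin> E" "(d, a) \<notin> E" "b \<noteq> c" "d \<noteq> a"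
  shows "{a, b, c, d} \<subseteq> pverts S \<or> {a, b, c, d} \<subseteq> pverts H"
proof -
  have S: "pair_graph S" "pverts S = A \<union> B" "A \<inter> B = {}" "independent_set S A" "clique S B"
    using assms(1) by (auto simp: split_partition_def)
  have symE: "(v, u) \<in> E" if "(u, v) \<in> E" for u v
    using that S(1) assms(2) by (auto simp: E_def dest: pair_graphD(4))
  have V: "u \<in> A \<union> B \<union> pverts H \<and> v \<in> A \<union> B \<union> pverts H" if "(u, v) \<in> E" for u v
    using that S(1,2) assms(2) by (auto simp: E_def dest: pair_graphD(2,3))
  have AA: "(u, v) \<notin> E" if "u \<in> A" "v \<in> A \<union> pverts H" for u v
  proof -
    have "(u, v) \<notin> parcs S" using that S(2,4) assms(3) pair_graphD(3)[OF S(1)]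
      unfolding independent_set_def by blast
    moreover have "u \<notin> pverts H" using that(1) S(2) assms(3) by blast
    moreover from this have "(u, v) \<notin> parcs H" using pair_graphD(2)[OF assms(2)] by blast
    moreover have "u \<notin> B" using that(1) S(3) by blast
    ultimately show ?thesis by (simp add: E_def)
  qed
  have BB: "(u, v) \<in> E" if "u \<in> B" "v \<in> B \<union> pverts H" "u \<noteq> v" for u v
    using that S(5) by (auto simp: E_def clique_def)
  have BH: "u \<noteq> v" if "u \<in> A \<union> B" "v \<in> pverts H" for u v
    using that S(2) assms(3) by auto
  \<comment> \<open>Where the next vertex can lie after an edge or a non-edge, starting from each of
    the three parts.\<close>
  have r1: "v \<in> B" if "(u, v) \<in> E" "u \<in> A" for u v
    using that V AA by blast
  have r2: "v \<in> A" if "(u, v) \<notin> E" "u \<noteq> v" "u \<in> B" "v \<in> A \<union> B \<union> pverts H" for u v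
    using that BB by blast
  have r3: "v \<in> B \<union> pverts H" if "(u, v) \<in> E" "u \<in> pverts H" for u v
    using that V AA symE by blast
  have r4: "v \<in> A \<union> pverts H" if "(u, v) \<notin> E" "u \<in> pverts H" "v \<in> A \<union> B \<union> pverts H" for u v
    using that BB symE BH by blast
  note Vs = V[OF cyc(1)] V[OF cyc(2)]
  have sym': "(b, a) \<in> E" "(d, c) \<in> E" "(c, b) \<notin> E" "(a, d) \<notin> E"
    using cyc symE by blast+
  consider "a \<in> A" | "a \<in> B" | "a \<in> pverts H" using Vs by blast
  then show ?thesis
  proof cases
    case 1
    then have "b \<in> B" using r1 cyc(1) by blast
    moreover from this have "c \<in> A" using r2[OF cyc(3,5)] Vs by blast
    moreover from this have "d \<in> B" using r1 cyc(2) by blast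
    ultimately show ?thesis using 1 S(2) by blast
  next
    case 2
    then have "d \<in> A" using r2[OF sym'(4)] cyc(6) Vs by blast
    moreover from this have "c \<in> B" using r1 sym'(2) by blast
    moreover from this have "b \<in> A" using r2[OF sym'(3)] cyc(5) Vs by blast
    ultimately show ?thesis using 2 S(2) by blast
  next
    case 3
    then have b: "b \<in> B \<union> pverts H" using r3 cyc(1) by blast
    \<comment> \<open>From \<open>d \<in> A\<close> the cycle would run through
      \<open>c \<in> B\<close> to \<open>b \<in> A\<close>, but \<open>a\<close> in \<open>H\<close>
      has no neighbour in \<open>A\<close>.\<close>
    have "d \<notin> A"
    proof
      assume "d \<in> A"
      then have "c \<in> B" using r1 sym'(2) by blast
      then have "b \<in> A" using r2[OF sym'(3)] cyc(5) Vs by blast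
      then show False using b S(2,3) BH by blast
    qed
    then have d: "d \<in> pverts H" using r4[OF sym'(4) 3] Vs by blast
    then have "c \<in> B \<union> pverts H" using r3 sym'(2) by blast
    then have c: "c \<in> pverts H" using BB[of c b] b sym'(3) cyc(3,5) BB[of b c] by blast
    then have "b \<in> pverts H" using b BB[of b c] cyc(3,5) by blast
    then show ?thesis using 3 d c by blast
  qed
qed

lemma compose_parcs_iff:
  assumes "splitted_graph (S, A, B)" "pair_graph H" "pverts S \<inter> pverts H = {}"
  shows "u \<in> pverts S \<Longrightarrow> v \<in> pverts S \<Longrightarrow> (u, v) \<in> parcs (compose (S, A, B) H) \<longleftrightarrow> (u, v) \<in> parcs S"
    and "u \<in> pverts H \<Longrightarrow> v \<in> pverts H \<Longrightarrow> (u, v) \<in> parcs (compose (S, A, B) H) \<longleftrightarrow> (u, v) \<in> parcs H"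
proof -
  have "pair_graph S" "B \<subseteq> pverts S" using assms(1) by (auto simp: split_partition_def)
  note S = pair_graphD[OF this(1)] and H = pair_graphD[OF assms(2)] and B = this(2)
  show "u \<in> pverts S \<Longrightarrow> v \<in> pverts S \<Longrightarrow> (u, v) \<in> parcs (compose (S, A, B) H) \<longleftrightarrow> (u, v) \<in> parcs S"
    "u \<in> pverts H \<Longrightarrow> v \<in> pverts H \<Longrightarrow> (u, v) \<in> parcs (compose (S, A, B) H) \<longleftrightarrow> (u, v) \<in> parcs H"
    using assms(3) B by (auto dest: S(2,3) H(2,3))
qed

text \<open>The patterns consist of edges, non-edges and inequalities, all of which an embedding
  preserves.\<close>

lemma obstruction_free_induced_copy:
  assumes free: "obstruction_free G" and wf: "pair_wf_digraph F" and copy: "induced_copy F G h"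
  shows "obstruction_free F"
proof -
  have K: "\<not> has_two_K2 G" and C: "\<not> has_C4 G" and Ch: "\<not> has_chair G"
    using free by (auto simp: obstruction_free_def)
  have iff: "(h u, h v) \<in> parcs G \<longleftrightarrow> (u, v) \<in> parcs F" "h u = h v \<longleftrightarrow> u = v"
    if "u \<in> pverts F \<and> v \<in> pverts F" for u v
    using that copy by (auto simp: induced_copy_def inj_on_eq_iff)
  have ends: "u \<in> pverts F \<and> v \<in> pverts F" if "(u, v) \<in> parcs F" for u v
    using pair_wf_digraphD[OF wf that] by blast
  have "\<not> has_two_K2 F"
  proof
    assume "has_two_K2 F"
    then obtain a b c d where *: "(a, b) \<in> parcs F" "(c, d) \<in> parcs F" "(a, c) \<notin> parcs F"
      "(a, d) \<notin> parcs F" "(b, c) \<notin> parcs F" "(b, d) \<notin> parcs F"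
      unfolding has_two_K2_def by blast
    with ends[OF *(1)] ends[OF *(2)] show False
      using K has_two_K2I[of "h a" "h b" G "h c" "h d"] by (simp add: iff)
  qed
  moreover have "\<not> has_C4 F"
  proof
    assume "has_C4 F"
    then obtain a b c d where *: "(a, b) \<in> parcs F" "(b, c) \<in> parcs F" "(c, d) \<in> parcs F"
      "(d, a) \<in> parcs F" "(a, c) \<notin> parcs F" "(b, d) \<notin> parcs F" "a \<noteq> c" "b \<noteq> d"
      unfolding has_C4_def by blast
    with ends[OF *(1)] ends[OF *(3)] show False
      using C has_C4I[of "h a" "h c" "h b" "h d" G] by (simp add: iff)
  qed
  moreover have "\<not> has_chair F"
  proof
    assume "has_chair F"
    then obtain a b c d e where *: "(a, e) \<in> parcs F" "(e, d) \<in> parcs F" "(d, b) \<in> parcs F"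
      "(d, c) \<in> parcs F" "(a, b) \<notin> parcs F" "(a, c) \<notin> parcs F" "(a, d) \<notin> parcs F"
      "(b, c) \<notin> parcs F" "(b, e) \<notin> parcs F" "(c, e) \<notin> parcs F" "b \<noteq> c"
      unfolding has_chair_def by blast
    with ends[OF *(1)] ends[OF *(3)] ends[OF *(4)] show False
      using Ch has_chairI[of "h b" "h c" "h a" "h e" G "h d"] by (simp add: iff)
  qed
  ultimately show ?thesis by (simp add: obstruction_free_def)
qed

text \<open>Both factors embed by the identity. Conversely, every pattern is made up of alternating
  4-cycles, which cannot straddle the two factors.\<close>

lemma obstruction_free_compose_iff:
  assumes "splitted_graph (S, A, B)" "pair_graph H" "pverts S \<inter> pverts H = {}"
  shows "obstruction_free (compose (S, A, B) H) \<longleftrightarrow> obstruction_free S \<and> obstruction_free H"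
proof
  assume *: "obstruction_free (compose (S, A, B) H)"
  have "pair_graph S" using assms(1) by simp
  then have "pair_wf_digraph S" "pair_wf_digraph H"
    using assms(2) by (auto intro: pair_graph_imp_pair_wf_digraph)
  moreover have "induced_copy S (compose (S, A, B) H) id" "induced_copy H (compose (S, A, B) H) id"
    using compose_parcs_iff[OF assms] by (simp_all add: induced_copy_def del: compose.simps) auto
  ultimately show "obstruction_free S \<and> obstruction_free H"
    using obstruction_free_induced_copy[OF *] by blast
next
  assume SH: "obstruction_free S \<and> obstruction_free H"
  define E where "E = parcs (compose (S, A, B) H)"
  note alt = alternating_cycle_compose[OF assms, folded E_def]
  note iff = compose_parcs_iff[OF assms, folded E_def]
  note G = pair_graphD[OF pair_graph_compose[OF assms], folded E_def]
  have "\<not> has_two_K2 (compose (S, A, B) H)"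
    unfolding has_two_K2_def E_def[symmetric]
  proof (intro notI, elim exE conjE)
    fix a b c d
    assume *: "(a, b) \<in> E" "(c, d) \<in> E" "(a, c) \<notin> E" "(a, d) \<notin> E" "(b, c) \<notin> E" "(b, d) \<notin> E"
    then have "{a, b, c, d} \<subseteq> pverts S \<or> {a, b, c, d} \<subseteq> pverts H"
      using G(4) by (intro alt) blast+
    then have "has_two_K2 S \<or> has_two_K2 H"
      using * has_two_K2I[of a b S c d] has_two_K2I[of a b H c d] by (auto simp: iff)
    then show False using SH by (auto simp: obstruction_free_def)
  qed
  moreover have "\<not> has_C4 (compose (S, A, B) H)"
    unfolding has_C4_def E_def[symmetric]
  proof (intro notI, elim exE conjE)
    fix a b c d
    assume *: "a \<noteq> c" "b \<noteq> d" "(a, b) \<in> E" "(b, c) \<in> E" "(c, d) \<in> E" "(d, a) \<in> E"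
      "(a, c) \<notin> E" "(b, d) \<notin> E"
    \<comment> \<open>In the order \<open>a, b, d, c\<close> the edges \<open>ab\<close>,
      \<open>dc\<close> alternate with the diagonals \<open>bd\<close>, \<open>ca\<close>.\<close>
    then have "{a, b, d, c} \<subseteq> pverts S \<or> {a, b, d, c} \<subseteq> pverts H"
      using G(4) by (intro alt) blast+
    then have "has_C4 S \<or> has_C4 H"
      using * has_C4I[of a c b d S] has_C4I[of a c b d H] by (auto simp: iff)
    then show False using SH by (auto simp: obstruction_free_def)
  qed
  moreover have "\<not> has_chair (compose (S, A, B) H)"
    unfolding has_chair_def E_def[symmetric]
  proof (intro notI, elim exE conjE)
    fix a b c d e
    assume *: "b \<noteq> c" "(a, e) \<in> E" "(e, d) \<in> E" "(d, b) \<in> E" "(d, c) \<in> E" "(a, b) \<notin> E"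
      "(a, c) \<notin> E" "(a, d) \<notin> E" "(b, c) \<notin> E" "(b, e) \<notin> E" "(c, e) \<notin> E"
    \<comment> \<open>These two alternating cycles cover the chair and share \<open>a\<close>, so
      they lie in the same factor.\<close>
    have "{a, e, b, d} \<subseteq> pverts S \<or> {a, e, b, d} \<subseteq> pverts H"
      "{a, e, c, d} \<subseteq> pverts S \<or> {a, e, c, d} \<subseteq> pverts H"
      using G(4) * by (intro alt; blast)+
    then have "{a, b, c, d, e} \<subseteq> pverts S \<or> {a, b, c, d, e} \<subseteq> pverts H"
      using assms(3) by auto
    then have "has_chair S \<or> has_chair H"
      using * has_chairI[of b c a e S d] has_chairI[of b c a e H d] by (auto simp: iff)
    then show False using SH by (auto simp: obstruction_free_def)
  qed
  ultimately show "obstruction_free (compose (S, A, B) H)"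
    by (simp add: obstruction_free_def)
qed

text \<open>The vertex set is carried through the induction because it yields the disjointness
  required for the next composition.\<close>

lemma obstruction_free_foldr_compose:
  assumes "\<forall>X\<in>set Xs. splitted_graph X" "pair_graph G0"
    and "sorted_wrt (\<lambda>C D. pverts C \<inter> pverts D = {}) (components Xs G0)"
  shows "pair_graph (foldr compose Xs G0) \<and>
    pverts (foldr compose Xs G0) = (\<Union>C\<in>set (components Xs G0). pverts C) \<and>
    (obstruction_free (foldr compose Xs G0) \<longleftrightarrow> (\<forall>C\<in>set (components Xs G0). obstruction_free C))"
  using assms
proof (induction Xs)
  case Nil
  then show ?case by (simp add: components_def)
next
  case (Cons X Xs)
  obtain S A B where X: "X = (S, A, B)" by (cases X)
  let ?H = "foldr compose Xs G0"
  have IH: "pair_graph ?H" "pverts ?H = (\<Union>C\<in>set (components Xs G0). pverts C)"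
    "obstruction_free ?H \<longleftrightarrow> (\<forall>C\<in>set (components Xs G0). obstruction_free C)"
    using Cons by (auto simp: components_def)
  have S: "splitted_graph (S, A, B)" using Cons.prems(1) X by simp
  have "\<forall>C\<in>set (components Xs G0). pverts S \<inter> pverts C = {}"
    using Cons.prems(3) by (simp add: X components_def)
  then have disj: "pverts S \<inter> pverts ?H = {}" unfolding IH(2) by auto
  have "foldr compose (X # Xs) G0 = compose (S, A, B) ?H" by (simp add: X)
  moreover have "components (X # Xs) G0 = S # components Xs G0" by (simp add: components_def X)
  ultimately show ?case
    using pair_graph_compose[OF S IH(1) disj] obstruction_free_compose_iff[OF S IH(1) disj] IH(2,3)
    by (simp del: compose.simps) simp
qed

text \<open>Recognises a decomposition from adjacencies inside \<open>G\<close>: the factors are the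
  subgraphs induced on \<open>A \<union> B\<close> and on \<open>W\<close>.\<close>

lemma decomposableI:
  assumes G: "pair_graph G" and V: "pverts G = A \<union> B \<union> W"
    and disj: "A \<inter> B = {}" "A \<inter> W = {}" "B \<inter> W = {}"
    and ne: "A \<union> B \<noteq> {}" "W \<noteq> {}"
    and A: "\<And>u v. u \<in> A \<Longrightarrow> v \<in> A \<union> W \<Longrightarrow> (u, v) \<notin> parcs G"
    and B: "\<And>u v. u \<in> B \<Longrightarrow> v \<in> B \<union> W \<Longrightarrow> u \<noteq> v \<Longrightarrow> (u, v) \<in> parcs G"
  shows "decomposable G"
proof -
  note g = pair_graphD[OF G]
  let ?ind = "\<lambda>U. \<lparr>pverts = U, parcs = parcs G \<inter> U \<times> U\<rparr>"
  have ind: "pair_graph (?ind U)" if "U \<subseteq> pverts G" for U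
    using that g finite_subset by (intro pair_graphI) (auto simp: sym_def)
  have "splitted_graph (?ind (A \<union> B), A, B)"
    using ind[of "A \<union> B"] V disj A B
    by (auto simp: split_partition_def independent_set_def clique_def)
  moreover have "pair_graph (?ind W)" using ind V by blast
  moreover have "G = compose (?ind (A \<union> B), A, B) (?ind W)"
  proof (rule pair_pre_digraph.equality)
    have "(u, v) \<in> parcs G \<longleftrightarrow> (u, v) \<in> parcs (compose (?ind (A \<union> B), A, B) (?ind W))" for u v
      using g(2-4)[of u v] g(4)[of v u] A[of u v] A[of v u] B[of u v] B[of v u] V disj by auto
    then show "parcs G = parcs (compose (?ind (A \<union> B), A, B) (?ind W))" by auto
  qed (use V in auto)
  ultimately show ?thesis
    unfolding decomposable_def using ne disj
    by (intro exI[of _ "?ind (A \<union> B)"] exI[of _ A] exI[of _ B] exI[of _ "?ind W"]) auto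
qed

section \<open>Spiders\<close>

text \<open>
  The graph with feet \<open>A\<close> and clique \<open>C\<close> in which \<open>g\<close> sends each clique vertex to the foot whose
  body vertex it replaces; \<open>t\<close> tells a spider of type (a) from one of type (b).
\<close>

definition spider_graph :: "bool \<Rightarrow> ('a \<Rightarrow> 'a) \<Rightarrow> 'a set \<Rightarrow> 'a set \<Rightarrow> 'a pair_pre_digraph" where
  "spider_graph t g A C = \<lparr>pverts = A \<union> C,
     parcs = {(x, y). x \<in> C \<and> y \<in> C \<and> x \<noteq> y} \<union>
       {(x, y). x \<in> A \<and> y \<in> C \<and> ((g y = x) = t)} \<union> {(x, y). x \<in> C \<and> y \<in> A \<and> ((g x = y) = t)}\<rparr>"

lemma spider_graph_cong:
  assumes "\<And>x. x \<in> C \<Longrightarrow> g x = g' x"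
  shows "spider_graph t g A C = spider_graph t g' A C"
  using assms by (auto simp: spider_graph_def)

text \<open>An independent set and a clique leave no room for two disjoint edges or a 4-cycle. In a
  chair, \<open>d\<close> and \<open>e\<close> would be clique vertices and \<open>a\<close>,
  \<open>b\<close>, \<open>c\<close> feet, with \<open>d\<close> adjacent to both \<open>b\<close>
  and \<open>c\<close> and \<open>e\<close> to neither. Then \<open>g\<close> would send
  \<open>d\<close> (if \<open>t\<close>) or \<open>e\<close> (otherwise) to both \<open>b\<close>
  and \<open>c\<close>.\<close>

lemma obstruction_free_spider_graph:
  assumes disj: "A \<inter> C = {}"
  shows "obstruction_free (spider_graph t g A C)"
proof -
  let ?E = "parcs (spider_graph t g A C)"
  have CC: "(u, v) \<in> ?E" if "u \<in> C" "v \<in> C" "u \<noteq> v" for u v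
    using that by (simp add: spider_graph_def)
  have AC: "(u, v) \<in> ?E \<longleftrightarrow> (g v = u) = t" "(v, u) \<in> ?E \<longleftrightarrow> (g v = u) = t"
    if "u \<in> A" "v \<in> C" for u v
    using that disj by (auto simp: spider_graph_def)
  have A: "v \<in> C" if "(u, v) \<in> ?E" "u \<in> A" for u v
    using that disj by (auto simp: spider_graph_def)
  have V: "u \<in> A \<union> C" "v \<in> A \<union> C" if "(u, v) \<in> ?E" for u v
    using that by (auto simp: spider_graph_def)
  have sym: "(v, u) \<in> ?E" if "(u, v) \<in> ?E" for u v
    using that by (auto simp: spider_graph_def)
  have "\<not> has_two_K2 (spider_graph t g A C)"
    unfolding has_two_K2_def
  proof (intro notI, elim exE conjE)
    fix a b c d
    assume *: "(a, b) \<in> ?E" "(c, d) \<in> ?E" "(a, c) \<notin> ?E" "(a, d) \<notin> ?E" "(b, c) \<notin> ?E" "(b, d) \<notin> ?E"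
    have "a \<in> C \<or> b \<in> C" "c \<in> C \<or> d \<in> C"
      using A V *(1,2) by blast+
    moreover have "a \<noteq> c" "a \<noteq> d" "b \<noteq> c" "b \<noteq> d"
      using * by (auto simp: spider_graph_def)
    ultimately show False using CC * by blast
  qed
  moreover have "\<not> has_C4 (spider_graph t g A C)"
    unfolding has_C4_def
  proof (intro notI, elim exE conjE)
    fix a b c d
    assume *: "a \<noteq> c" "b \<noteq> d" "(a, b) \<in> ?E" "(b, c) \<in> ?E" "(c, d) \<in> ?E" "(d, a) \<in> ?E"
      "(a, c) \<notin> ?E" "(b, d) \<notin> ?E"
    have "a \<in> A \<or> c \<in> A" "b \<in> A \<or> d \<in> A"
      using CC V[OF *(3)] V[OF *(5)] * by blast+
    then show False using A[OF *(3)] A[OF *(4)] A[OF *(5)] A[OF *(6)] disj by blast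
  qed
  moreover have "\<not> has_chair (spider_graph t g A C)"
    unfolding has_chair_def
  proof (intro notI, elim exE conjE)
    fix a b c d e
    assume *: "b \<noteq> c" "(a, e) \<in> ?E" "(e, d) \<in> ?E" "(d, b) \<in> ?E" "(d, c) \<in> ?E" "(a, b) \<notin> ?E"
      "(a, c) \<notin> ?E" "(a, d) \<notin> ?E" "(b, c) \<notin> ?E" "(b, e) \<notin> ?E" "(c, e) \<notin> ?E"
    have ne: "a \<noteq> b" "a \<noteq> c" "a \<noteq> d" "b \<noteq> e" "c \<noteq> e"
      using * by blast+
    have "b \<in> A \<or> c \<in> A" using CC[of b c] V[OF *(4)] V[OF *(5)] *(1,9) by blast
    then have d: "d \<in> C" using A[of b d] A[of c d] sym *(4,5) by blast
    then have a: "a \<in> A" using CC[of a d] V[OF *(2)] *(8) ne(3) by blast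
    then have e: "e \<in> C" using A[OF *(2)] by blast
    then have bc: "b \<in> A" "c \<in> A" using CC[of b e] CC[of c e] V[OF *(4)] V[OF *(5)] *(10,11) ne(4,5) e by blast+
    have "(g e = a) = t" "(g d = a) \<noteq> t" "(g d = b) = t" "(g d = c) = t" "(g e = b) \<noteq> t" "(g e = c) \<noteq> t"
      using *(2,4,5,8,10,11) by (simp_all only: not_False_eq_True AC[OF a e] AC[OF a d] AC[OF bc(1) d] AC[OF bc(2) d]
          AC[OF bc(1) e] AC[OF bc(2) e])
    then show False using *(1) ne by (cases t) auto
  qed
  ultimately show ?thesis by (simp add: obstruction_free_def)
qed

text \<open>The new vertices inherit the foot \<open>g v\<close>, so substitution only enlarges the
  clique and extends \<open>g\<close>: the class of these graphs is closed under expansion.\<close>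

lemma substitute_spider_graph:
  assumes disj: "A \<inter> C = {}" and v: "v \<in> C"
    and K: "parcs K = {(x, y). x \<in> pverts K \<and> y \<in> pverts K \<and> x \<noteq> y}"
    and K_disj: "pverts K \<inter> (A \<union> C - {v}) = {}"
  shows "substitute (spider_graph t g A C) v K =
    spider_graph t (\<lambda>x. if x \<in> pverts K then g v else g x) A (C - {v} \<union> pverts K)" (is "?L = ?R")
proof (rule pair_pre_digraph.equality)
  have vA: "v \<notin> A" using disj v by blast
  then show "pverts ?L = pverts ?R"
    using K_disj by (auto simp: substitute_def spider_graph_def)
  have nb: "neighbours (spider_graph t g A C) v = (C - {v}) \<union> {a \<in> A. (g v = a) = t}"
    using v vA by (auto simp: neighbours_def spider_graph_def)
  have "(x, y) \<in> parcs ?L \<longleftrightarrow> (x, y) \<in> parcs ?R" for x y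
  proof -
    define P where "P z a \<longleftrightarrow> (g z = a) = t" for z a
    define P' where "P' z a \<longleftrightarrow> (if z \<in> pverts K then P v a else P z a)" for z a
    have KA: "z \<notin> pverts K" if "z \<in> A" for z using that K_disj vA by blast
    \<comment> \<open>The substituted graph may reuse the name \<open>v\<close>, but no other vertex
      of the clique.\<close>
    have KC: "z = v" if "z \<in> C" "z \<in> pverts K" for z using that K_disj by blast
    have "(x, y) \<in> parcs ?L \<longleftrightarrow>
       x \<noteq> v \<and> y \<noteq> v \<and> (x \<in> C \<and> y \<in> C \<and> x \<noteq> y \<or> x \<in> A \<and> y \<in> C \<and> P y x \<or> x \<in> C \<and> y \<in> A \<and> P x y) \<or>
       x \<in> pverts K \<and> y \<in> pverts K \<and> x \<noteq> y \<or>
       x \<in> pverts K \<and> (y \<in> C \<and> y \<noteq> v \<or> y \<in> A \<and> P v y) \<or>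
       y \<in> pverts K \<and> (x \<in> C \<and> x \<noteq> v \<or> x \<in> A \<and> P v x)"
      unfolding substitute_def nb K by (simp add: spider_graph_def P_def[symmetric]) blast
    moreover have "(x, y) \<in> parcs ?R \<longleftrightarrow>
       x \<in> C - {v} \<union> pverts K \<and> y \<in> C - {v} \<union> pverts K \<and> x \<noteq> y \<or>
       x \<in> A \<and> y \<in> C - {v} \<union> pverts K \<and> P' y x \<or> x \<in> C - {v} \<union> pverts K \<and> y \<in> A \<and> P' x y"
      unfolding P'_def P_def spider_graph_def by simp
    ultimately show ?thesis
      using KA[of x] KA[of y] KC[of x] KC[of y] vA
      by (cases "x \<in> pverts K"; cases "y \<in> pverts K") (auto simp: P'_def)
  qed
  then show "parcs ?L = parcs ?R" by auto
qed simp

text \<open>Take for \<open>g\<close> the inverse of the bijection from feet to body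
  vertices.\<close>

lemma headless_spider_imp_spider_graph:
  assumes "headless_spider J A B"
  shows "\<exists>t g. J = spider_graph t g A B"
proof -
  have J: "pair_graph J" and V: "A \<union> B = pverts J" and disj: "A \<inter> B = {}"
    and ind: "independent_set J A" and cl: "clique J B"
    using assms by (auto simp: headless_spider_def split_partition_def)
  obtain f where f: "bij_betw f A B"
    and nb: "(\<forall>v\<in>A. neighbours J v = {f v}) \<or> (\<forall>v\<in>A. neighbours J v = B - {f v})"
    using assms by (auto simp: headless_spider_def)
  define t where "t \<longleftrightarrow> (\<forall>v\<in>A. neighbours J v = {f v})"
  define g where "g = the_inv_into A f"
  have g: "g y = x \<longleftrightarrow> f x = y" if "x \<in> A" "y \<in> B" for x y
    using that f unfolding g_def bij_betw_def
    by (metis f_the_inv_into_f the_inv_into_f_f)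
  have fB: "f x \<in> B" if "x \<in> A" for x using f that by (auto simp: bij_betw_def)
  have AB: "(x, y) \<in> parcs J \<longleftrightarrow> (g y = x) = t" if "x \<in> A" "y \<in> B" for x y
  proof -
    have "(x, y) \<in> parcs J \<longleftrightarrow> y \<in> neighbours J x" by (simp add: neighbours_def)
    also have "\<dots> \<longleftrightarrow> (f x = y) = t"
    proof (cases t)
      case True
      then show ?thesis using that by (auto simp: t_def)
    next
      case False
      then have "neighbours J x = B - {f x}" using nb that by (auto simp: t_def)
      then show ?thesis using False that by auto
    qed
    finally show ?thesis using g that by simp
  qed
  note Jd = pair_graphD[OF J]
  have "(x, y) \<in> parcs J \<longleftrightarrow> (x, y) \<in> parcs (spider_graph t g A B)" for x y
  proof (cases "x \<in> A \<union> B \<and> y \<in> A \<union> B")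
    case False
    then show ?thesis using Jd(2,3)[of x y] V by (auto simp: spider_graph_def)
  next
    case True
    have "(x, y) \<notin> parcs J" if "x \<in> A" "y \<in> A"
      using that ind by (auto simp: independent_set_def)
    moreover have "(x, y) \<in> parcs J \<longleftrightarrow> x \<noteq> y" if "x \<in> B" "y \<in> B"
      using that cl Jd(5) by (auto simp: clique_def)
    moreover have "(x, y) \<in> parcs J \<longleftrightarrow> (y, x) \<in> parcs J" using Jd(4) by blast
    ultimately show ?thesis
      using True AB[of x y] AB[of y x] disj by (auto simp: spider_graph_def)
  qed
  then have "parcs J = parcs (spider_graph t g A B)" by auto
  moreover have "pverts J = pverts (spider_graph t g A B)" using V by (simp add: spider_graph_def)
  ultimately show ?thesis by (intro exI) (rule pair_pre_digraph.equality; simp)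
qed

text \<open>The invariant \<open>B \<subseteq> C\<close> ensures that each further substitution
  takes place at a clique vertex and not at a foot.\<close>

lemma expanded_spider_imp_spider_graph:
  assumes "expanded_spider G B"
  shows "\<exists>t g A C. G = spider_graph t g A C \<and> A \<inter> C = {} \<and> B \<subseteq> C"
  using assms
proof induction
  case (spider J A B)
  then have "A \<inter> B = {}" by (auto simp: headless_spider_def split_partition_def)
  then show ?case using headless_spider_imp_spider_graph[OF spider] by blast
next
  case (expand G B v n K)
  obtain t g A C where G: "G = spider_graph t g A C" and disj: "A \<inter> C = {}" and B: "B \<subseteq> C"
    using expand.IH by blast
  have K: "parcs K = {(x, y). x \<in> pverts K \<and> y \<in> pverts K \<and> x \<noteq> y}"
    using expand.hyps by (simp add: complete_digraph_pair_def)
  have K_disj: "pverts K \<inter> (A \<union> C - {v}) = {}"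
    using expand.hyps by (simp add: G spider_graph_def)
  have v: "v \<in> C" using expand.hyps B by blast
  have "A \<inter> (C - {v} \<union> pverts K) = {}" "B - {v} \<subseteq> C - {v} \<union> pverts K"
    using disj K_disj v B by auto
  then show ?case
    using substitute_spider_graph[OF disj v K K_disj] unfolding G by blast
qed

text \<open>Here \<open>r\<close> picks one clique vertex for each foot, a section of
  \<open>g\<close>; it is the bijection of the spider.\<close>

lemma headless_spider_spider_graph:
  assumes "finite A" "card A \<ge> 2" and disj: "A \<inter> r ` A = {}"
    and gr: "\<And>a. a \<in> A \<Longrightarrow> g (r a) = a"
  shows "headless_spider (spider_graph t g A (r ` A)) A (r ` A)" (is "headless_spider ?J _ _")
proof -
  have inj: "inj_on r A" using gr by (metis inj_onI)
  have "pair_graph ?J"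
    using assms(1) disj by (intro pair_graphI) (auto simp: spider_graph_def sym_def)
  moreover have "split_partition ?J A (r ` A)"
    using disj by (auto simp: split_partition_def independent_set_def clique_def spider_graph_def)
  moreover have "card A = card (r ` A)" using inj by (simp add: card_image)
  moreover have "bij_betw r A (r ` A)" using inj by (simp add: bij_betw_def)
  moreover have "(\<forall>v\<in>A. neighbours ?J v = {r v}) \<or> (\<forall>v\<in>A. neighbours ?J v = r ` A - {r v})"
  proof (cases t)
    case True
    then have "\<forall>v\<in>A. neighbours ?J v = {r v}"
      using disj gr by (auto simp: neighbours_def spider_graph_def)
    then show ?thesis ..
  next
    case False
    then have "\<forall>v\<in>A. neighbours ?J v = r ` A - {r v}"
      using disj gr by (auto simp: neighbours_def spider_graph_def)
    then show ?thesis ..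
  qed
  ultimately show ?thesis using assms(2) unfolding headless_spider_def by blast
qed

text \<open>The clique vertices with the same foot are the twins that replace one body vertex.
  Starting from a headless spider on one representative \<open>r a\<close> for each foot, the
  representatives are expanded to their fibres one after the other.\<close>

lemma top_expanded_spider_spider_graph:
  assumes fin: "finite C" and "card A \<ge> 2" and disj: "A \<inter> C = {}" and g: "g ` C = A"
  shows "top_expanded_spider (spider_graph t g A C)"
proof -
  define r where "r = inv_into C g"
  have r: "r a \<in> C" "g (r a) = a" if "a \<in> A" for a
    using that g unfolding r_def by (auto simp: inv_into_into f_inv_into_f)
  have inj: "inj_on r A" using r by (metis inj_onI)
  have finA: "finite A" using fin g by blast
  \<comment> \<open>\<open>T\<close> is the set of feet whose fibres have already been filled
    in.\<close>
  have "expanded_spider (spider_graph t g A (r ` A \<union> {c \<in> C. g c \<in> T})) (r ` (A - T))"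
    if "T \<subseteq> A" "finite T" for T
    using that(2,1)
  proof (induction T rule: finite_induct)
    case empty
    have "headless_spider (spider_graph t g A (r ` A)) A (r ` A)"
      using finA assms(2) disj r by (intro headless_spider_spider_graph) auto
    then show ?case by (simp add: expanded_spider.spider)
  next
    case (insert a T)
    let ?C = "r ` A \<union> {c \<in> C. g c \<in> T}"
    \<comment> \<open>The fibre over \<open>a\<close> contains \<open>r a\<close>, so the vertex
      being replaced returns as a vertex of the complete graph.\<close>
    let ?Q = "{c \<in> C. g c = a}"
    let ?K = "\<lparr>pverts = ?Q, parcs = {(x, y). x \<in> ?Q \<and> y \<in> ?Q \<and> x \<noteq> y}\<rparr>"
    have a: "a \<in> A" "T \<subseteq> A" using insert.prems by auto
    have IH: "expanded_spider (spider_graph t g A ?C) (r ` (A - T))"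
      using insert.IH a by blast
    have ra: "r a \<in> ?Q" using r a by blast
    have K: "complete_digraph (card ?Q) (with_proj ?K)"
      using fin by (auto simp: complete_digraph_pair_def)
    have card: "card ?Q \<ge> 1" using ra fin card_gt_0_iff[of ?Q] by fastforce
    have Q_disj: "?Q \<inter> (A \<union> ?C - {r a}) = {}"
      using disj r insert.hyps by auto
    have C_disj: "A \<inter> ?C = {}" using disj r by auto
    have "expanded_spider (substitute (spider_graph t g A ?C) (r a) ?K) (r ` (A - T) - {r a})"
      using Q_disj a insert.hyps
      by (intro expanded_spider.expand[OF IH _ K card]) (auto simp: spider_graph_def)
    also have "substitute (spider_graph t g A ?C) (r a) ?K =
        spider_graph t (\<lambda>x. if x \<in> pverts ?K then g (r a) else g x) A (?C - {r a} \<union> pverts ?K)"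
      using Q_disj a C_disj by (intro substitute_spider_graph) auto
    \<comment> \<open>On the fibre \<open>g\<close> already has the constant value
      \<open>a = g (r a)\<close>.\<close>
    also have "\<dots> = spider_graph t g A (?C - {r a} \<union> pverts ?K)"
      using r a by (intro spider_graph_cong) auto
    also have "?C - {r a} \<union> pverts ?K = r ` A \<union> {c \<in> C. g c \<in> insert a T}"
      using ra by auto
    also have "r ` (A - T) - {r a} = r ` (A - insert a T)"
      using inj a by (auto simp: inj_on_eq_iff)
    finally show ?case .
  qed
  from this[of A] have "expanded_spider (spider_graph t g A (r ` A \<union> {c \<in> C. g c \<in> A})) {}"
    using finA by simp
  moreover have "r ` A \<union> {c \<in> C. g c \<in> A} = C" using r g by auto
  ultimately show ?thesis unfolding top_expanded_spider_def by auto
qed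

section \<open>Graphs without induced two disjoint edges or 4-cycles\<close>

text \<open>The orientation of sides and diagonals is chosen so that a rotation merely permutes the
  ten conjuncts.\<close>

definition induced_C5 :: "'a pair_pre_digraph \<Rightarrow> 'a \<Rightarrow> 'a \<Rightarrow> 'a \<Rightarrow> 'a \<Rightarrow> 'a \<Rightarrow> bool" where
  "induced_C5 G a b c d e \<longleftrightarrow>
     (a, b) \<in> parcs G \<and> (b, c) \<in> parcs G \<and> (c, d) \<in> parcs G \<and> (d, e) \<in> parcs G \<and> (e, a) \<in> parcs G \<and>
     (a, c) \<notin> parcs G \<and> (b, d) \<notin> parcs G \<and> (c, e) \<notin> parcs G \<and> (d, a) \<notin> parcs G \<and> (e, b) \<notin> parcs G"

lemma induced_C5_rotate: "induced_C5 G a b c d e \<Longrightarrow> induced_C5 G b c d e a"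
  by (simp add: induced_C5_def)

text \<open>
  Take a clique \<open>B\<close> that maximises the sum of \<open>card V + deg v\<close>: it has the maximum number of
  vertices and, among the maximum cliques, the largest sum of degrees.
\<close>

lemma induced_C5_if_not_split_graph:
  assumes G: "pair_graph G" and K: "\<not> has_two_K2 G" and C4: "\<not> has_C4 G"
    and not_split: "\<not> split_graph G"
  shows "\<exists>a b c d e. induced_C5 G a b c d e"
proof -
  let ?V = "pverts G" and ?E = "parcs G"
  note g = pair_graphD[OF G]
  have no_K: False if "(a, b) \<in> ?E" "(c, d) \<in> ?E" "(a, c) \<notin> ?E" "(a, d) \<notin> ?E" "(b, c) \<notin> ?E" "(b, d) \<notin> ?E"
    for a b c d using has_two_K2I[OF that] K by simp
  have no_C4: False if "a \<noteq> c" "b \<noteq> d" "(a, b) \<in> ?E" "(b, c) \<in> ?E" "(c, d) \<in> ?E" "(d, a) \<in> ?E"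
    "(a, c) \<notin> ?E" "(b, d) \<notin> ?E" for a b c d using has_C4I[OF that] C4 by simp
  \<comment> \<open>On \<open>V\<close> the weights lie between \<open>card V\<close> and
    \<open>2 * card V\<close>, the upper bound being strict, so trading one vertex of a clique for
    two always increases the sum.\<close>
  define w where "w v = card ?V + card (neighbours G v)" for v
  have nbV: "neighbours G v \<subseteq> ?V" for v using g(3) by (auto simp: neighbours_def)
  then have fin_nb: "finite (neighbours G v)" for v using g(1) finite_subset by blast
  have deg: "card (neighbours G v) < card ?V" if "v \<in> ?V" for v
    using nbV g(1,5) that by (intro psubset_card_mono) (auto simp: neighbours_def)
  let ?Cl = "{B. clique G B}"
  have "finite ?Cl"
    by (rule finite_subset[of _ "Pow ?V"]) (use g(1) in \<open>auto simp: clique_def\<close>)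
  then have fin: "finite (sum w ` ?Cl)" by (rule finite_imageI)
  have "clique G {}" by (simp add: clique_def)
  then have "Max (sum w ` ?Cl) \<in> sum w ` ?Cl" by (intro Max_in[OF fin]) blast
  then obtain B where B: "clique G B" and "sum w B = Max (sum w ` ?Cl)" by auto
  then have max: "sum w B' \<le> sum w B" if "clique G B'" for B'
    using Max_ge[OF fin, of "sum w B'"] that by auto
  have BV: "B \<subseteq> ?V" and BB: "\<And>u v. u \<in> B \<Longrightarrow> v \<in> B \<Longrightarrow> u \<noteq> v \<Longrightarrow> (u, v) \<in> ?E"
    using B by (auto simp: clique_def)
  have finB: "finite B" using BV g(1) finite_subset by blast
  have "split_graph G" if "independent_set G (?V - B)"
    using that G B BV unfolding split_graph_def split_partition_def
    by (intro conjI exI[of _ "?V - B"] exI[of _ B]) auto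
  then obtain x0 y0 where xy0: "x0 \<in> ?V - B" "y0 \<in> ?V - B" "(x0, y0) \<in> ?E"
    using not_split by (auto simp: independent_set_def)
  let ?M = "\<lambda>x. {u \<in> B. (x, u) \<notin> ?E}"
  have M_ne: "?M x \<noteq> {}" if "x \<in> ?V - B" for x
  proof
    assume "?M x = {}"
    then have "clique G (insert x B)" using that B g(4) by (auto simp: clique_def)
    from max[OF this] have "w x = 0" using that finB by simp
    then show False using that g(1) by (auto simp: w_def)
  qed
  \<comment> \<open>Otherwise \<open>x0 y0 u v\<close> would be an induced 4-cycle.\<close>
  have "?M x0 \<subseteq> ?M y0 \<or> ?M y0 \<subseteq> ?M x0"
  proof (rule ccontr)
    assume "\<not> ?thesis"
    then obtain u v where "u \<in> B" "(x0, u) \<notin> ?E" "(y0, u) \<in> ?E" "v \<in> B" "(y0, v) \<notin> ?E" "(x0, v) \<in> ?E"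
      by blast
    moreover from this have "u \<noteq> v" by blast
    ultimately show False
      using no_C4[of x0 u y0 v] xy0 BB[of u v] g(4) by blast
  qed
  then obtain x y where xy: "x \<in> ?V - B" "y \<in> ?V - B" "(x, y) \<in> ?E" and sub: "?M x \<subseteq> ?M y"
    using xy0 g(4) by blast
  obtain z where z: "z \<in> B" "(x, z) \<notin> ?E" using M_ne[OF xy(1)] by blast
  have yz: "(y, z) \<notin> ?E" using z sub by blast
  \<comment> \<open>A second vertex \<open>u\<close> missed by \<open>x\<close>, hence also by
    \<open>y\<close>, would give the disjoint edges \<open>xy\<close> and \<open>uz\<close>.\<close>
  have Mx: "u = z" if "u \<in> B" "(x, u) \<notin> ?E" for u
    using no_K[of x y u z] that z xy sub BB[of u z] by blast
  have ne: "x \<noteq> y" "x \<noteq> z" "y \<noteq> z" using xy z g(5) by auto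
  have cl1: "clique G (insert x (B - {z}))"
    using xy(1) B Mx g(4) by (fastforce simp: clique_def)
  \<comment> \<open>If \<open>y\<close> missed only \<open>z\<close> in \<open>B\<close>, then
    trading \<open>z\<close> for \<open>x\<close> and \<open>y\<close> would give a heavier
    clique.\<close>
  obtain u where u: "u \<in> B" "u \<noteq> z" "(y, u) \<notin> ?E"
  proof (rule ccontr)
    assume "\<not> thesis"
    then have "\<forall>u\<in>B. u \<noteq> z \<longrightarrow> (y, u) \<in> ?E" using that by blast
    then have "clique G (insert y (insert x (B - {z})))"
      using cl1 xy g(4) by (auto simp: clique_def)
    from max[OF this] have "w y + w x \<le> w z"
      using finB xy ne z(1) by (simp add: sum.remove[OF finB z(1)])
    moreover have "w z < 2 * card ?V" using deg z(1) BV by (auto simp: w_def)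
    ultimately show False by (simp add: w_def)
  qed
  have xu: "(x, u) \<in> ?E" using Mx u by blast
  \<comment> \<open>Trading \<open>z\<close> for \<open>x\<close> again gives a clique, so the
    degree of \<open>x\<close> is at most that of \<open>z\<close>. As \<open>y\<close> is adjacent
    to \<open>x\<close> only, \<open>z\<close> must have a neighbour \<open>p\<close> that
    \<open>x\<close> lacks.\<close>
  have "w x \<le> w z"
    using max[OF cl1] finB xy z(1) by (simp add: sum.remove[OF finB z(1)])
  then have card_le: "card (neighbours G x) \<le> card (neighbours G z)" by (simp add: w_def)
  have "y \<in> neighbours G x" "y \<notin> neighbours G z"
    using xy yz g(4) by (auto simp: neighbours_def)
  then have "\<not> neighbours G z \<subseteq> neighbours G x"
    using card_le psubset_card_mono[OF fin_nb, of "neighbours G z" x] by auto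
  then obtain p where p: "(z, p) \<in> ?E" "(x, p) \<notin> ?E" by (auto simp: neighbours_def)
  have zx: "(z, x) \<notin> ?E" "(z, y) \<notin> ?E" "(p, x) \<notin> ?E" "(u, y) \<notin> ?E"
    using z yz p u g(4) by blast+
  \<comment> \<open>Otherwise \<open>zp\<close> and \<open>xy\<close> are two disjoint induced
    edges; likewise an edge \<open>pu\<close> would close the 4-cycle
    \<open>p y x u\<close>.\<close>
  have py: "(p, y) \<in> ?E" using no_K[of z p x y] p(1) xy(3) zx by blast
  have "p \<noteq> x" using p z g(4) by blast
  have pu: "(p, u) \<notin> ?E"
  proof
    assume "(p, u) \<in> ?E"
    moreover have "y \<noteq> u" using u xy by blast
    ultimately show False
      using no_C4[of p x y u] py xu xy(3) u(3) zx \<open>p \<noteq> x\<close> g(4) by blast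
  qed
  have "induced_C5 G p y x u z"
    unfolding induced_C5_def
    using py xy(3) xu u z p pu zx yz BB[of u z] g(4) by blast
  then show ?thesis by blast
qed

text \<open>If \<open>u\<close> is adjacent to \<open>a\<close> but not to \<open>b\<close>, it
  misses \<open>c\<close> by the 4-cycle \<open>u a b c\<close>, then \<open>e\<close> by the edges
  \<open>bc\<close>, \<open>ue\<close>, then \<open>d\<close> by the 4-cycle \<open>u a e d\<close>;
  now \<open>ua\<close> and \<open>cd\<close> are two disjoint induced edges.\<close>

lemma induced_C5_attach_step:
  assumes G: "pair_graph G" and K: "\<not> has_two_K2 G" and C4: "\<not> has_C4 G"
    and C5: "induced_C5 G a b c d e" and u: "u \<notin> {a, b, c, d, e}" "(u, a) \<in> parcs G"
  shows "(u, b) \<in> parcs G"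
proof (rule ccontr)
  assume ub: "(u, b) \<notin> parcs G"
  note g4 = pair_graphD(4)[OF G]
  note c = C5[unfolded induced_C5_def]
  have ca: "(c, a) \<notin> parcs G" and ec: "(e, c) \<notin> parcs G" and ac: "(a, d) \<notin> parcs G"
    and be: "(b, e) \<notin> parcs G" and rev: "(c, b) \<in> parcs G" "(d, c) \<in> parcs G" "(e, d) \<in> parcs G"
    "(a, e) \<in> parcs G"
    using c g4 by blast+
  have ne: "a \<noteq> c" "a \<noteq> d" using c rev by blast+
  have "(u, c) \<notin> parcs G"
    using has_C4I[of u b a c G] C4 u ub c ne g4 by blast
  moreover from this have "(u, e) \<notin> parcs G"
    using has_two_K2I[of b c G u e] K ub c ca ec be g4 by blast
  moreover from this have "(u, d) \<notin> parcs G"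
    using has_C4I[of u e a d G] C4 u c rev ac ne g4 by blast
  ultimately show False
    using has_two_K2I[of u a G c d] K u c ac by blast
qed

lemma digraph_iso_C5_if_induced_C5:
  assumes G: "pair_graph G" and V: "pverts G = {a, b, c, d, e}" and C5: "induced_C5 G a b c d e"
  shows "digraph_iso (with_proj G) (with_proj (cycle_graph 5))"
proof -
  note c = C5[unfolded induced_C5_def] and g = pair_graphD[OF G]
  let ?h = "(!) [a, b, c, d, e]"
  have sym: "(b, a) \<in> parcs G" "(c, b) \<in> parcs G" "(d, c) \<in> parcs G" "(e, d) \<in> parcs G"
    "(a, e) \<in> parcs G" "(c, a) \<notin> parcs G" "(d, b) \<notin> parcs G" "(e, c) \<notin> parcs G"
    "(a, d) \<notin> parcs G" "(b, e) \<notin> parcs G"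
    using c g(4) by blast+
  have ne: "a \<noteq> b" "a \<noteq> c" "a \<noteq> d" "a \<noteq> e" "b \<noteq> c" "b \<noteq> d" "b \<noteq> e" "c \<noteq> d" "c \<noteq> e" "d \<noteq> e"
    using c sym g(5) by blast+
  have "induced_copy (cycle_graph 5) G ?h"
    unfolding induced_copy_def cycle_graph_sel V using c sym ne by (simp add: g(5))
  moreover have "?h ` pverts (cycle_graph 5) = pverts G"
    unfolding cycle_graph_sel V by simp
  moreover have "pair_wf_digraph (cycle_graph 5)"
    by (auto simp: pair_wf_digraph_def cycle_graph_sel)
  ultimately show ?thesis
    using digraph_iso_with_proj_iff[OF pair_graph_imp_pair_wf_digraph[OF G]] by blast
qed

lemma indecomposable_not_split_graph:
  assumes G: "pair_graph G" and K: "\<not> has_two_K2 G" and C4: "\<not> has_C4 G"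
    and not_split: "\<not> split_graph G" and indec: "indecomposable G"
  shows "digraph_iso (with_proj G) (with_proj (cycle_graph 5))"
proof -
  obtain a b c d e where C5: "induced_C5 G a b c d e"
    using induced_C5_if_not_split_graph[OF G K C4 not_split] by blast
  note g = pair_graphD[OF G] and c = C5[unfolded induced_C5_def]
  let ?W = "{a, b, c, d, e}"
  define A where "A = {u \<in> pverts G - ?W. (u, a) \<notin> parcs G}"
  define B where "B = {u \<in> pverts G - ?W. (u, a) \<in> parcs G}"
  have W: "?W \<subseteq> pverts G" using c g(2) by blast
  \<comment> \<open>Applied to all five rotations, the attachment step carries adjacency once round
    the cycle.\<close>
  have all: "(u, v) \<in> parcs G \<longleftrightarrow> (u, a) \<in> parcs G" if u: "u \<notin> ?W" and "v \<in> ?W" for u v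
  proof -
    note r1 = induced_C5_rotate[OF C5] and step = induced_C5_attach_step[OF G K C4]
    note r2 = induced_C5_rotate[OF r1]
    note r3 = induced_C5_rotate[OF r2]
    note r4 = induced_C5_rotate[OF r3]
    have "u \<notin> {b, c, d, e, a}" "u \<notin> {c, d, e, a, b}" "u \<notin> {d, e, a, b, c}" "u \<notin> {e, a, b, c, d}"
      using u by blast+
    then show ?thesis
      using step[OF C5 u] step[OF r1, of u] step[OF r2, of u] step[OF r3, of u] step[OF r4, of u]
        \<open>v \<in> ?W\<close> by auto
  qed
  have "pverts G = A \<union> B \<union> ?W" using W by (auto simp: A_def B_def)
  moreover have "A \<inter> B = {}" "A \<inter> ?W = {}" "B \<inter> ?W = {}" "?W \<noteq> {}" by (auto simp: A_def B_def)
  moreover have "(u, v) \<notin> parcs G" if "u \<in> A" "v \<in> A \<union> ?W" for u v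
  proof (cases "v \<in> ?W")
    case True
    then show ?thesis using all[of u v] that by (auto simp: A_def)
  next
    case False
    then have "v \<in> A" using that by blast
    then have "(u, a) \<notin> parcs G" "(u, b) \<notin> parcs G" "(v, a) \<notin> parcs G" "(v, b) \<notin> parcs G"
      using all[of u b] all[of v b] that(1) by (auto simp: A_def)
    \<comment> \<open>An edge inside \<open>A\<close> would be disjoint from and unlinked to the
      edge \<open>ab\<close>.\<close>
    then show ?thesis using has_two_K2I[of u v G a b] K c by blast
  qed
  moreover have "(u, v) \<in> parcs G" if "u \<in> B" "v \<in> B \<union> ?W" "u \<noteq> v" for u v
  proof (cases "v \<in> ?W")
    case True
    then show ?thesis using all[of u v] that by (auto simp: B_def)
  next
    case False
    then have "v \<in> B" using that by blast
    then have "(u, a) \<in> parcs G" "(u, c) \<in> parcs G" "(v, a) \<in> parcs G" "(v, c) \<in> parcs G"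
      using all[of u c] all[of v c] that(1) by (auto simp: B_def)
    moreover have "a \<noteq> c" using c g(4) by blast
    \<comment> \<open>Two non-adjacent vertices of \<open>B\<close> would form the 4-cycle
      \<open>u a v c\<close>.\<close>
    ultimately show ?thesis using has_C4I[of u v a c G] C4 c that(3) g(4) by blast
  qed
  ultimately have "A \<union> B = {}"
    using decomposableI[OF G, of A B ?W] indec unfolding indecomposable_def by blast
  then have "pverts G = ?W" using W by (auto simp: A_def B_def)
  then show ?thesis using digraph_iso_C5_if_induced_C5[OF G _ C5] by blast
qed

text \<open>The first two patterns are excluded by running through all pairs of arcs. A chair would
  need a vertex with three distinct neighbours, while every degree is two.\<close>

lemma obstruction_free_C5: "obstruction_free (cycle_graph 5)"
proof -
  define S :: "(nat \<times> nat) set" where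
    "S = {(0, 1), (1, 2), (2, 3), (3, 4), (4, 0), (1, 0), (2, 1), (3, 2), (4, 3), (0, 4)}"
  have E: "parcs (cycle_graph 5) = S" unfolding cycle_graph_sel S_def by auto
  have "\<forall>(a, b)\<in>S. \<forall>(c, d)\<in>S. (a, c) \<in> S \<or> (a, d) \<in> S \<or> (b, c) \<in> S \<or> (b, d) \<in> S"
    unfolding S_def by code_simp
  then have "\<not> has_two_K2 (cycle_graph 5)"
    unfolding has_two_K2_def E by blast
  moreover have "\<forall>(a, b)\<in>S. \<forall>(c, d)\<in>S. a \<noteq> c \<longrightarrow> b \<noteq> d \<longrightarrow> (b, c) \<in> S \<longrightarrow> (d, a) \<notin> S"
    unfolding S_def by code_simp
  then have "\<not> has_C4 (cycle_graph 5)"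
    unfolding has_C4_def E by blast
  moreover have "\<forall>(e, d)\<in>S. \<forall>(d', b)\<in>S. d = d' \<longrightarrow> b \<noteq> e \<longrightarrow>
      (\<forall>(d', c)\<in>S. d = d' \<longrightarrow> b = c \<or> c = e)"
    unfolding S_def by code_simp
  then have "b = c \<or> b = e \<or> c = e" if "(e, d) \<in> S" "(d, b) \<in> S" "(d, c) \<in> S" for b c d e
    using that by blast
  then have "\<not> has_chair (cycle_graph 5)"
    unfolding has_chair_def E by blast
  ultimately show ?thesis by (simp add: obstruction_free_def)
qed

lemma obstruction_free_if_iso_C5:
  assumes G: "pair_graph G" and iso: "digraph_iso (with_proj G) (with_proj (cycle_graph 5))"
  shows "obstruction_free G"
proof -
  have wf: "pair_wf_digraph G" "pair_wf_digraph (cycle_graph 5)"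
    using G by (auto simp: pair_graph_imp_pair_wf_digraph pair_wf_digraph_def[of "cycle_graph 5"] cycle_graph_sel)
  then have "digraph_iso (with_proj (cycle_graph 5)) (with_proj G)"
    by (intro digraph_iso_swap[OF _ iso]) (simp add: wf_digraph_wp_iff)
  then show ?thesis
    using digraph_iso_with_proj_iff[OF wf(2,1)] obstruction_free_induced_copy[OF obstruction_free_C5 wf(1)]
    by blast
qed

section \<open>Indecomposable split graphs\<close>

text \<open>
  Let \<open>N x = K \<union> {p}\<close> and \<open>N y = K \<union> {q}\<close>. If all members contain \<open>K\<close>, then \<open>K\<close> is empty. A member
  missing some \<open>k \<in> K\<close> is \<open>K \<union> {p, q} - {k}\<close>, and this confines all members to \<open>K \<union> {p, q}\<close>.
\<close>

lemma exchange_family: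
  assumes swap: "\<And>x y. x \<in> B \<Longrightarrow> y \<in> B \<Longrightarrow>
      N x = N y \<or> (\<exists>p q. N x - N y = {p} \<and> N y - N x = {q})"
    and sub: "\<And>x. x \<in> B \<Longrightarrow> N x \<subseteq> A" and ne: "A \<noteq> {}"
    and covered: "\<And>a. a \<in> A \<Longrightarrow> \<exists>x\<in>B. a \<in> N x"
    and missed: "\<And>a. a \<in> A \<Longrightarrow> \<exists>x\<in>B. a \<notin> N x"
  shows "(\<exists>g. \<forall>x\<in>B. N x = {g x}) \<or> (\<exists>g. \<forall>x\<in>B. g x \<in> A \<and> N x = A - {g x})"
proof -
  have out: "\<exists>q. N x - N y = {p} \<and> N y - N x = {q}"
    if "x \<in> B" "y \<in> B" "p \<in> N x" "p \<notin> N y" for x y p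
  proof -
    have "N x \<noteq> N y" using that by blast
    then obtain p' q where "N x - N y = {p'}" "N y - N x = {q}"
      using swap[OF \<open>x \<in> B\<close> \<open>y \<in> B\<close>] by metis
    moreover from this have "p = p'" using \<open>p \<in> N x\<close> \<open>p \<notin> N y\<close> by blast
    ultimately show ?thesis by blast
  qed
  obtain a where "a \<in> A" using ne by blast
  then obtain x y where xy: "x \<in> B" "y \<in> B" "N x \<noteq> N y" using covered missed by metis
  then obtain p q where p: "N x - N y = {p}" and q: "N y - N x = {q}" using swap by metis
  have p': "p \<in> N x" "p \<notin> N y" and q': "q \<in> N y" "q \<notin> N x" using p q by blast+
  show ?thesis
  proof (cases "\<exists>z\<in>B. \<not> N x \<inter> N y \<subseteq> N z")
    case False
    \<comment> \<open>A common element of \<open>N x\<close> and \<open>N y\<close> would lie in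
      every member, contrary to \<open>missed\<close>.\<close>
    then have "N x \<inter> N y = {}" using sub[OF xy(1)] missed by blast
    then have Nx: "N x = {p}" using p by blast
    have "\<exists>r. N z = {r}" if "z \<in> B" for z
      using swap[OF xy(1) that] Nx by (auto simp: insert_Diff_if split: if_splits)
    then show ?thesis by metis
  next
    case True
    then obtain z k where z: "z \<in> B" and k: "k \<in> N x" "k \<in> N y" "k \<notin> N z" by blast
    obtain s where s: "N x - N z = {k}" "N z - N x = {s}"
      using out[OF xy(1) z k(1,3)] by blast
    have s': "N y - N z = {k}"
      using out[OF xy(2) z k(2,3)] by blast
    have "q \<in> N z" using s' q' k(1) by (metis DiffI singletonD)
    then have Nz: "N z - N x = {q}" using s(2) q'(2) by (metis DiffI singletonD)
    have U: "N u \<subseteq> insert q (N x)" if u: "u \<in> B" for u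
    proof
      fix r assume r: "r \<in> N u"
      show "r \<in> insert q (N x)"
      proof (rule ccontr)
        assume r_out: "r \<notin> insert q (N x)"
        obtain r' where ux: "N u - N x = {r}" "N x - N u = {r'}"
          using out[OF u xy(1) r] r_out by blast
        have "r \<notin> N y" "r \<notin> N z" using r_out q Nz by blast+
        then have uy: "N u - N y = {r}" and uz: "N u - N z = {r}"
          using out[OF u xy(2) r] out[OF u z r] by blast+
        \<comment> \<open>Since \<open>r\<close> is the only element of \<open>N u\<close> outside
          \<open>N y\<close> and the only one outside \<open>N z\<close>, both \<open>p\<close> and
          \<open>k\<close> are missing from \<open>N u\<close>. These are two elements of
          \<open>N x - N u\<close>, which is a singleton.\<close>
        have "p \<notin> N u" using uy p' r_out by (metis DiffI singletonD insertI2)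
        moreover have "k \<notin> N u" using uz k r_out by (metis DiffI singletonD insertI2)
        ultimately show False using ux(2) k p' by (metis DiffI singletonD)
      qed
    qed
    have A: "A = insert q (N x)"
      using U covered sub[OF xy(1)] sub[OF xy(2)] q'(1) by blast
    have "\<exists>r. r \<in> A \<and> N u = A - {r}" if u: "u \<in> B" for u
    proof (cases "N u = N x")
      case True
      then show ?thesis using A q' by blast
    next
      case False
      then obtain r r' where "N x - N u = {r}" "N u - N x = {r'}"
        using swap[OF xy(1) u] by auto
      moreover from this have "r' = q" using U[OF u] by blast
      ultimately have "r \<in> A" "N u = A - {r}" using A q' by blast+
      then show ?thesis by blast
    qed
    then show ?thesis by metis
  qed
qed

text \<open>\<open>N x\<close> is the trace on \<open>A\<close> of the neighbourhood of a clique
  vertex \<open>x\<close>. Once these traces form an exchange family, the foot \<open>h x\<close>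
  singled out by each \<open>x\<close> exhibits \<open>G\<close> as a
  \<open>spider_graph\<close>.\<close>

lemma top_expanded_spider_if_indecomposable:
  assumes G: "pair_graph G" and chair: "\<not> has_chair G" and "split_graph G"
    and indec: "indecomposable G" and card: "card (pverts G) > 1"
  shows "top_expanded_spider G"
proof -
  obtain A B where V: "A \<union> B = pverts G" and disj: "A \<inter> B = {}"
    and ind: "independent_set G A" and cl: "clique G B"
    using assms(3) by (auto simp: split_graph_def split_partition_def)
  note g = pair_graphD[OF G]
  have AA: "(u, v) \<notin> parcs G" if "u \<in> A" "v \<in> A" for u v
    using that ind by (auto simp: independent_set_def)
  have BB: "(u, v) \<in> parcs G" if "u \<in> B" "v \<in> B" "u \<noteq> v" for u v
    using that cl by (auto simp: clique_def)
  have fin: "finite A" "finite B" using V g(1) by (metis finite_Un)+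
  \<comment> \<open>Every decomposition used below splits off \<open>A'\<close> and
    \<open>B'\<close> as the left factor: \<open>A'\<close> has no neighbours in
    \<open>B - B'\<close>, and \<open>B'\<close> is complete to \<open>A - A'\<close>.\<close>
  have not_dec: False
    if "A' \<subseteq> A" "B' \<subseteq> B" "A' \<union> B' \<noteq> {}" "A' \<union> B' \<noteq> pverts G"
      "\<And>a b. a \<in> A' \<Longrightarrow> b \<in> B - B' \<Longrightarrow> (a, b) \<notin> parcs G"
      "\<And>a b. a \<in> A - A' \<Longrightarrow> b \<in> B' \<Longrightarrow> (a, b) \<in> parcs G" for A' B'
  proof -
    have "decomposable G"
    proof (rule decomposableI[OF G, of A' B' "(A - A') \<union> (B - B')"])
      show "pverts G = A' \<union> B' \<union> ((A - A') \<union> (B - B'))" using that(1,2) V by blast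
      show "(A - A') \<union> (B - B') \<noteq> {}" using that(1,2,4) V by blast
      show "(u, v) \<notin> parcs G" if "u \<in> A'" "v \<in> A' \<union> ((A - A') \<union> (B - B'))" for u v
        using that AA \<open>A' \<subseteq> A\<close> \<open>\<And>a b. a \<in> A' \<Longrightarrow> b \<in> B - B' \<Longrightarrow> (a, b) \<notin> parcs G\<close> by blast
      show "(u, v) \<in> parcs G" if "u \<in> B'" "v \<in> B' \<union> ((A - A') \<union> (B - B'))" "u \<noteq> v" for u v
        using that BB g(4) \<open>B' \<subseteq> B\<close> \<open>\<And>a b. a \<in> A - A' \<Longrightarrow> b \<in> B' \<Longrightarrow> (a, b) \<in> parcs G\<close> by blast
    qed (use that disj in blast)+
    then show False using indec by (simp add: indecomposable_def)
  qed
  have single: "{v} \<noteq> pverts G" for v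
    using card by (metis card_1_singleton_iff One_nat_def less_irrefl)
  define N where "N x = {a \<in> A. (a, x) \<in> parcs G}" for x
  have N_sub: "N x \<subseteq> A" for x by (auto simp: N_def)
  have fin_N: "finite (N x)" for x using N_sub fin finite_subset by blast
  \<comment> \<open>An isolated vertex of \<open>A\<close> would split off as a left factor.\<close>
  have covered: "\<exists>x\<in>B. a \<in> N x" if "a \<in> A" for a
    using not_dec[of "{a}" "{}"] single[of a] that by (auto simp: N_def)
  have missed: "\<exists>x\<in>B. a \<notin> N x" if "a \<in> A" for a
  proof (rule ccontr)
    assume *: "\<not> ?thesis"
    \<comment> \<open>A vertex of \<open>A\<close> adjacent to all of \<open>B\<close> would be a
      right factor by itself.\<close>
    have "(A - {a}) \<union> B \<noteq> {}" "(A - {a}) \<union> B \<noteq> pverts G"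
      using single[of a] that V disj by blast+
    then show False using not_dec[of "A - {a}" B] * that by (auto simp: N_def)
  qed
  have A_ne: "A \<noteq> {}"
  proof
    assume A: "A = {}"
    then obtain b where "b \<in> B" using V card by fastforce
    then show False using not_dec[of "{}" "{b}"] single[of b] A by auto
  qed
  \<comment> \<open>Otherwise there is a chair with centre \<open>x\<close>, leaves \<open>p\<close>
    and \<open>q\<close>, and the path \<open>x y r\<close>.\<close>
  have diff: "p = q" if "x \<in> B" "y \<in> B" "p \<in> N x - N y" "q \<in> N x - N y" "r \<in> N y - N x" for x y p q r
  proof (rule ccontr)
    assume "p \<noteq> q"
    moreover have "x \<noteq> y" using that by blast
    moreover have "(x, p) \<in> parcs G" "(x, q) \<in> parcs G" using that g(4) by (auto simp: N_def)
    ultimately show False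
      using has_chairI[of p q r y G x] chair that BB[of y x] AA by (auto simp: N_def)
  qed
  have comparable: "N x \<subseteq> N y \<or> N y \<subseteq> N x \<or> (\<exists>p q. N x - N y = {p} \<and> N y - N x = {q})"
    if "x \<in> B" "y \<in> B" for x y
  proof (rule ccontr)
    assume *: "\<not> ?thesis"
    then obtain p q where p: "p \<in> N x - N y" and q: "q \<in> N y - N x" by blast
    have "N x - N y = {p}" using diff[OF that _ p q] p by blast
    moreover have "N y - N x = {q}" using diff[OF that(2,1) _ q p] q by blast
    ultimately show False using * by blast
  qed
  have card_swap: "card (N x) = card (N y)" if "N x - N y = {p}" "N y - N x = {q}" for x y p q
  proof -
    have "N x = insert p (N x \<inter> N y)" "N y = insert q (N x \<inter> N y)" "p \<notin> N x \<inter> N y" "q \<notin> N x \<inter> N y"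
      using that by blast+
    then show ?thesis using fin_N by (metis card_insert_disjoint finite_Int)
  qed
  have card_eq: "\<not> card (N y0) < card (N x0)" if "x0 \<in> B" "y0 \<in> B" for x0 y0
  proof
    assume less: "card (N y0) < card (N x0)"
    \<comment> \<open>\<open>B'\<close> collects the vertices with large traces and
      \<open>A'\<close> the feet missed by one of them. Traces of different sizes are nested, so a
      foot in \<open>A'\<close> is also missed by everything in \<open>B - B'\<close>.\<close>
    define B' where "B' = {x \<in> B. card (N x0) \<le> card (N x)}"
    define A' where "A' = A - (\<Inter>x\<in>B'. N x)"
    have sub: "N y \<subseteq> N x" if "x \<in> B'" "y \<in> B - B'" for x y
    proof -
      have "card (N y) < card (N x)" "x \<in> B" "y \<in> B" using that by (auto simp: B'_def)
      then show ?thesis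
        using comparable[of x y] card_swap[of x y] card_mono[OF fin_N, of "N x" y] by auto
    qed
    have x0: "x0 \<in> B'" and y0: "y0 \<in> B - B'" using that less by (auto simp: B'_def)
    show False
    proof (rule not_dec[of A' B'])
      show "A' \<union> B' \<noteq> pverts G" using y0 disj V by (auto simp: A'_def)
      show "(a, b) \<notin> parcs G" if "a \<in> A'" "b \<in> B - B'" for a b
        using that sub by (auto simp: A'_def N_def)
      show "(a, b) \<in> parcs G" if "a \<in> A - A'" "b \<in> B'" for a b
        using that by (auto simp: A'_def N_def)
    qed (use x0 in \<open>auto simp: A'_def B'_def\<close>)
  qed
  have swap: "N x = N y \<or> (\<exists>p q. N x - N y = {p} \<and> N y - N x = {q})" if "x \<in> B" "y \<in> B" for x y
    using comparable[OF that] card_eq[OF that] card_eq[OF that(2,1)]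
      psubset_card_mono[OF fin_N, of "N x" y] psubset_card_mono[OF fin_N, of "N y" x]
    by blast
  \<comment> \<open>The flag \<open>t\<close> merges the two outcomes, singletons and their
    complements, in the form used by \<open>spider_graph\<close>.\<close>
  obtain t h where gN: "\<And>x a. x \<in> B \<Longrightarrow> a \<in> A \<Longrightarrow> a \<in> N x \<longleftrightarrow> (h x = a) = t"
    and gA: "\<And>x. x \<in> B \<Longrightarrow> h x \<in> A"
  proof -
    from exchange_family[of B N A, OF swap N_sub A_ne covered missed]
    consider h where "\<forall>x\<in>B. N x = {h x}" | h where "\<forall>x\<in>B. h x \<in> A \<and> N x = A - {h x}" by blast
    then show thesis
    proof cases
      case 1
      then show thesis using N_sub by (intro that[of h True]) auto
    next
      case 2
      then show thesis by (intro that[of h False]) auto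
    qed
  qed
  have "a \<in> h ` B" if "a \<in> A" for a
  proof (cases t)
    case True
    then show ?thesis using covered[OF that] gN that by blast
  next
    case False
    then show ?thesis using missed[OF that] gN that by blast
  qed
  then have hB: "h ` B = A" using gA by blast
  \<comment> \<open>With a single foot all clique vertices would have the same trace, so the foot
    could not be both covered and missed.\<close>
  have "card A \<noteq> 1"
  proof
    assume "card A = 1"
    then obtain a where a: "A = {a}" using card_1_singletonE by blast
    have "h x = a" if "x \<in> B" for x using gA[OF that] a by blast
    then show False using covered[of a] missed[of a] gN a by blast
  qed
  then have card_A: "card A \<ge> 2" using A_ne fin(1) by (simp add: Suc_le_eq card_gt_0_iff order.strict_iff_order numeral_2_eq_2)
  have "(x, y) \<in> parcs G \<longleftrightarrow> (x, y) \<in> parcs (spider_graph t h A B)" for x y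
  proof (cases "x \<in> A \<union> B \<and> y \<in> A \<union> B")
    case False
    then show ?thesis using g(2,3)[of x y] V by (auto simp: spider_graph_def)
  next
    case True
    have AB: "(u, v) \<in> parcs G \<longleftrightarrow> (h v = u) = t" if "u \<in> A" "v \<in> B" for u v
      using gN[OF that(2,1)] that(1) by (simp add: N_def)
    have "(x, y) \<in> parcs G \<longleftrightarrow> (y, x) \<in> parcs G" "x = y \<Longrightarrow> (x, y) \<notin> parcs G" using g(4,5) by blast+
    then show ?thesis
      using True AB[of x y] AB[of y x] AA[of x y] BB[of x y] disj by (auto simp: spider_graph_def)
  qed
  then have "parcs G = parcs (spider_graph t h A B)" by auto
  then have "G = spider_graph t h A B"
    using V by (intro pair_pre_digraph.equality) (auto simp: spider_graph_def)
  then show ?thesis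
    using top_expanded_spider_spider_graph[OF fin(2) card_A disj hB] by simp
qed

section \<open>Trivial components and assembly of the equivalence\<close>

lemma obstruction_free_if_card_le_1:
  assumes G: "pair_graph G" and "card (pverts G) \<le> 1"
  shows "obstruction_free G"
proof -
  note g = pair_graphD[OF G]
  have "u = v" if "u \<in> pverts G" "v \<in> pverts G" for u v
    using that assms(2) g(1) by (metis One_nat_def card_le_Suc0_iff_eq)
  then have "(u, v) \<notin> parcs G" for u v using g(2,3,5) by metis
  then show ?thesis
    by (simp add: obstruction_free_def has_two_K2_def has_C4_def has_chair_def)
qed

theorem theorem2p9:
  fixes G G0 :: "'a pair_pre_digraph" and Xs :: "'a splitted list"
  assumes "pair_graph G"
    and "canonical_decomposition G Xs G0"
  shows "free_of {two_K2, cycle_graph 4, chair} G \<longleftrightarrow>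
    (split_graph G0 \<or> digraph_iso (with_proj G0) (with_proj (cycle_graph 5))) \<and>
    (\<forall>C \<in> set (components Xs G0).
       split_graph C \<and> indecomposable C \<and> card (pverts C) > 1 \<longrightarrow> top_expanded_spider C)"
proof -
  have Xs: "\<forall>X\<in>set Xs. splitted_graph X" and G0: "pair_graph G0"
    and indec: "\<forall>C\<in>set (components Xs G0). indecomposable C"
    and sorted: "sorted_wrt (\<lambda>C D. pverts C \<inter> pverts D = {}) (components Xs G0)"
    and G: "G = foldr compose Xs G0"
    using assms(2) by (auto simp: canonical_decomposition_def)
  have split: "split_graph (fst X)" if "X \<in> set Xs" for X
    using Xs that by (cases X) (fastforce simp: split_graph_def)
  have graph: "pair_graph C" if "C \<in> set (components Xs G0)" for C
    using that G0 split by (auto simp: components_def split_graph_def)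
  have G0_in: "G0 \<in> set (components Xs G0)" by (simp add: components_def)
  \<comment> \<open>Freeness passes to the components, so the rest compares two conditions on each
    component separately.\<close>
  have "free_of {two_K2, cycle_graph 4, chair} G \<longleftrightarrow>
      (\<forall>C\<in>set (components Xs G0). obstruction_free C)"
    using free_of_iff_obstruction_free[OF assms(1)] obstruction_free_foldr_compose[OF Xs G0 sorted]
    by (simp add: G)
  also have "\<dots> \<longleftrightarrow> (split_graph G0 \<or> digraph_iso (with_proj G0) (with_proj (cycle_graph 5))) \<and>
    (\<forall>C \<in> set (components Xs G0).
       split_graph C \<and> indecomposable C \<and> card (pverts C) > 1 \<longrightarrow> top_expanded_spider C)"
    (is "_ \<longleftrightarrow> ?G0 \<and> ?TES")
  proof
    assume free: "\<forall>C\<in>set (components Xs G0). obstruction_free C"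
    then have ?TES
      using top_expanded_spider_if_indecomposable graph by (auto simp: obstruction_free_def)
    moreover have ?G0
      using indecomposable_not_split_graph[OF G0] free indec G0_in by (auto simp: obstruction_free_def)
    ultimately show "?G0 \<and> ?TES" by blast
  next
    assume R: "?G0 \<and> ?TES"
    show "\<forall>C\<in>set (components Xs G0). obstruction_free C"
    proof
      fix C assume C: "C \<in> set (components Xs G0)"
      \<comment> \<open>Components other than \<open>G0\<close> are split because they carry a split
        partition.\<close>
      then have "split_graph C \<or> digraph_iso (with_proj C) (with_proj (cycle_graph 5))"
        using R split by (auto simp: components_def)
      then consider "digraph_iso (with_proj C) (with_proj (cycle_graph 5))" |
        "card (pverts C) \<le> 1" | "top_expanded_spider C"
        using R C indec by force
      then show "obstruction_free C"
      proof cases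
        case 1
        then show ?thesis using obstruction_free_if_iso_C5 graph[OF C] by blast
      next
        case 2
        then show ?thesis using obstruction_free_if_card_le_1 graph[OF C] by blast
      next
        case 3
        then show ?thesis
          using expanded_spider_imp_spider_graph obstruction_free_spider_graph
          unfolding top_expanded_spider_def by blast
      qed
    qed
  qed
  finally show ?thesis .
qed

end
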